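(* Let $G$ be a finite group and let $p$ be a prime with $\gcd(p,|G|)=1$, so that $\mathbb{F}_pG$ is semisimple. Suppose the Wedderburn decomposition of $\mathbb{F}_pG$ is $$\mathbb{F}_pG\cong\bigoplus_{i=1}^k M_{n_i}(\mathbb{F}_{p^{m_i}}).$$ Then for every $r\ge 1$ there is a ring isomorphism $$\mathbb{Z}_{p^r}G\cong\bigoplus_{i=1}^k M_{n_i}(\mathbb{Z}_{p^r}[\xi_{m_i}]),$$ where $\mathbb{Z}_{p^r}[\xi_{m_i}]=\mathbb{Z}_{p^r}[x]/\langle h_i(x)\rangle$ with $\xi_{m_i}=x+\langle h_i(x)\rangle$, and $h_i(x)\in\mathbb{Z}_{p^r}[x]$ is a monic basic irreducible polynomial of degree $m_i$.
   Context: $\mathbb{Z}_{p^r}$ denotes the ring of integers modulo $p^r$; $\mathbb{Z}_{p^r}G$ and $\mathbb{F}_pG$ are group rings. A polynomial in $\mathbb{Z}_{p^r}[x]$ is basic irreducible if its reduction modulo $p$ is irreducible in $\mathbb{F}_p[x]$; for every $m\ge 1$ a monic basic irreducible polynomial of degree $m$ exists, and the quotient of $\mathbb{Z}_{p^r}[x]$ by the ideal it generates is called the Galois ring of characteristic $p^r$ and cardinality $p^{rm}$. *)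

theory Defs
  imports
    "HOL-Algebra.UnivPoly"
    "HOL-Algebra.Chinese_Remainder"
    "HOL-Algebra.Ring_Divisibility"
    "HOL-Number_Theory.Residues"
    "Jordan_Normal_Form.Matrix"
begin

text \<open>Restricting the convolution sum to the support of \<open>f\<close> keeps it finite for infinite \<open>G\<close>
  as well (\<^const>\<open>finsum\<close> over an infinite set is zero by convention).\<close>

definition group_ring ::
  "('r, 's) ring_scheme \<Rightarrow> ('g, 't) monoid_scheme \<Rightarrow> ('g \<Rightarrow> 'r) ring" where
  "group_ring R G =
     \<lparr>carrier = {f \<in> carrier G \<rightarrow>\<^sub>E carrier R. finite {x \<in> carrier G. f x \<noteq> \<zero>\<^bsub>R\<^esub>}},
      monoid.mult = (\<lambda>f g. \<lambda>x\<in>carrier G.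
        \<Oplus>\<^bsub>R\<^esub>y\<in>{y \<in> carrier G. f y \<noteq> \<zero>\<^bsub>R\<^esub>}. f y \<otimes>\<^bsub>R\<^esub> g (inv\<^bsub>G\<^esub> y \<otimes>\<^bsub>G\<^esub> x)),
      one = (\<lambda>x\<in>carrier G. if x = \<one>\<^bsub>G\<^esub> then \<one>\<^bsub>R\<^esub> else \<zero>\<^bsub>R\<^esub>),
      zero = (\<lambda>x\<in>carrier G. \<zero>\<^bsub>R\<^esub>),
      add = (\<lambda>f g. \<lambda>x\<in>carrier G. f x \<oplus>\<^bsub>R\<^esub> g x)\<rparr>"

text \<open>The library's \<^const>\<open>ring_mat\<close> needs entries from a type-class ring; here the entries lie
  in a ring given by a carrier.\<close>

definition matrix_ring :: "nat \<Rightarrow> ('r, 's) ring_scheme \<Rightarrow> 'r mat ring" where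
  "matrix_ring n R =
     \<lparr>carrier = {A \<in> carrier_mat n n. \<forall>i<n. \<forall>j<n. A $$ (i, j) \<in> carrier R},
      monoid.mult = (\<lambda>A B. mat n n
        (\<lambda>(i, j). \<Oplus>\<^bsub>R\<^esub>l\<in>{..<n}. A $$ (i, l) \<otimes>\<^bsub>R\<^esub> B $$ (l, j))),
      one = mat n n (\<lambda>(i, j). if i = j then \<one>\<^bsub>R\<^esub> else \<zero>\<^bsub>R\<^esub>),
      zero = mat n n (\<lambda>_. \<zero>\<^bsub>R\<^esub>),
      add = (\<lambda>A B. mat n n (\<lambda>(i, j). A $$ (i, j) \<oplus>\<^bsub>R\<^esub> B $$ (i, j)))\<rparr>"

definition ring_direct_sum :: "nat \<Rightarrow> (nat \<Rightarrow> ('r, 's) ring_scheme) \<Rightarrow> 'r list ring" where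
  "ring_direct_sum k S = RDirProd_list (map S [0..<k])"

abbreviation Zmod :: "nat \<Rightarrow> int ring" where
  "Zmod q \<equiv> residue_ring (int q)"

definition monic_UP :: "('r, 's) ring_scheme \<Rightarrow> (nat \<Rightarrow> 'r) \<Rightarrow> bool" where
  "monic_UP R f \<longleftrightarrow> f \<in> carrier (UP R) \<and> up_ring.coeff (UP R) f (deg R f) = \<one>\<^bsub>R\<^esub>"

text \<open>Elements of \<^term>\<open>UP (Zmod (p ^ r))\<close> are coefficient sequences with values in
  \<open>{0..p ^ r - 1}\<close>, so the pointwise remainder is the reduction map to \<^term>\<open>UP (Zmod p)\<close>.\<close>

definition basic_irreducible :: "nat \<Rightarrow> nat \<Rightarrow> (nat \<Rightarrow> int) \<Rightarrow> bool" where
  "basic_irreducible p r f \<longleftrightarrow>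
     f \<in> carrier (UP (Zmod (p ^ r))) \<and>
     ring_irreducible\<^bsub>UP (Zmod p)\<^esub> (\<lambda>j. up_ring.coeff (UP (Zmod (p ^ r))) f j mod int p)"

definition poly_quotient :: "('r, 's) ring_scheme \<Rightarrow> (nat \<Rightarrow> 'r) \<Rightarrow> (nat \<Rightarrow> 'r) set ring" where
  "poly_quotient R h = UP R Quot (Idl\<^bsub>UP R\<^esub> {h})"

end

theory Submission
  imports Defs
begin

text \<open>Let \<open>B\<close> be the direct sum of the matrix rings over the Galois rings. Any two fields with
  \<open>p ^ m\<close> elements are isomorphic, so reducing entries modulo \<open>p\<close> and applying the Wedderburn
  isomorphism maps \<open>B\<close> onto the group ring over \<open>F\<^sub>p\<close>, with kernel \<open>pB\<close>. As \<open>|G|\<close> is invertible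
  modulo \<open>p ^ r\<close>, the obstructions in the second cohomology of \<open>G\<close> vanish, and the embedding of
  \<open>G\<close> into that group ring lifts, modulo higher and higher powers of \<open>p\<close>, to a multiplicative
  map from \<open>G\<close> to \<open>B\<close>. Its linear extension to the group ring modulo \<open>p ^ r\<close> is surjective,
  being so modulo the nilpotent ideal \<open>pB\<close>, and injective, because elements of \<open>B\<close> killed by
  \<open>p ^ (r - 1)\<close> lie in \<open>pB\<close>.\<close>

section \<open>Lifts of rings along reduction modulo a prime\<close>

text \<open>Having the same reduction modulo \<open>p\<close> does not make two lifts isomorphic:
  \<open>Z/p^2[x]/(x^2)\<close> and \<open>Z/p^2[x]/(x^2 - p)\<close> are free of the same rank and
  agree modulo \<open>p\<close>, but \<open>p\<close> is a square only in the second. So the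
  isomorphism over \<open>F_p\<close> does not lift for formal reasons, and the group order has to
  enter; it does so only through the average in \<open>improve_multiplicativity\<close>. Of the
  target, only this much is ever used: a map onto its reduction with the multiples of
  \<open>p\<close> as kernel, and which elements the powers of \<open>p\<close> annihilate. This is
  \<open>p_lift\<close>, and it can be checked on components and matrix entries one at a time. All
  scalars are integers acting by \<open>add_pow\<close>, so no module over a residue ring
  appears.\<close>

lemma add_pow_hom:
  assumes "abelian_group R" "abelian_group S"
    and "\<And>x. x \<in> carrier R \<Longrightarrow> f x \<in> carrier S"
    and "\<And>x y. x \<in> carrier R \<Longrightarrow> y \<in> carrier R \<Longrightarrow> f (x \<oplus>\<^bsub>R\<^esub> y) = f x \<oplus>\<^bsub>S\<^esub> f y"
    and "a \<in> carrier R"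
  shows "f (add_pow R (k::int) a) = add_pow S k (f a)"
proof -
  have "group_hom (add_monoid R) (add_monoid S) f"
    using assms by (auto simp: group_hom_def group_hom_axioms_def hom_def abelian_group.a_group)
  from group_hom.hom_int_pow[OF this, of a k] assms show ?thesis
    by (simp add: add_pow_def)
qed

lemma zero_hom:
  assumes "abelian_group R" "abelian_group S"
    and "\<And>x. x \<in> carrier R \<Longrightarrow> f x \<in> carrier S"
    and "\<And>x y. x \<in> carrier R \<Longrightarrow> y \<in> carrier R \<Longrightarrow> f (x \<oplus>\<^bsub>R\<^esub> y) = f x \<oplus>\<^bsub>S\<^esub> f y"
  shows "f \<zero>\<^bsub>R\<^esub> = \<zero>\<^bsub>S\<^esub>"
proof -
  have "group_hom (add_monoid R) (add_monoid S) f"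
    using assms by (auto simp: group_hom_def group_hom_axioms_def hom_def abelian_group.a_group)
  from group_hom.hom_one[OF this] show ?thesis by simp
qed

text \<open>Additivity alone is asked, here and in \<open>add_pow_hom\<close>, because some of the
  maps are not multiplicative: \<open>add_pow B k\<close> in a sum over the group, a matrix entry or
  a polynomial coefficient in an integer multiple.\<close>

lemma finsum_hom:
  assumes "abelian_group R" "abelian_group S"
    and f: "\<And>x. x \<in> carrier R \<Longrightarrow> f x \<in> carrier S"
    and fa: "\<And>x y. x \<in> carrier R \<Longrightarrow> y \<in> carrier R \<Longrightarrow> f (x \<oplus>\<^bsub>R\<^esub> y) = f x \<oplus>\<^bsub>S\<^esub> f y"
    and "g \<in> A \<rightarrow> carrier R"
  shows "f (\<Oplus>\<^bsub>R\<^esub>i\<in>A. g i) = (\<Oplus>\<^bsub>S\<^esub>i\<in>A. f (g i))"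
proof -
  interpret R: abelian_group R by fact
  interpret S: abelian_group S by fact
  have z: "f \<zero>\<^bsub>R\<^esub> = \<zero>\<^bsub>S\<^esub>" by (rule zero_hom) fact+
  show ?thesis using assms(5)
  proof (induction A rule: infinite_finite_induct)
    case (insert x A)
    then show ?case
      by (simp add: R.finsum_insert S.finsum_insert fa f Pi_def)
  qed (simp_all add: z)
qed

text \<open>The last clause replaces freeness of \<open>B\<close> over the integers modulo \<open>p ^ r\<close>; together with the
  others it determines the additive structure of \<open>B\<close> from that of \<open>C\<close>.\<close>

definition p_lift ::
  "int \<Rightarrow> nat \<Rightarrow> ('b, 'm) ring_scheme \<Rightarrow> ('c, 'n) ring_scheme \<Rightarrow> ('b \<Rightarrow> 'c) \<Rightarrow> bool" where
  "p_lift p r B C \<pi> \<longleftrightarrow> ring B \<and> ring C \<and> \<pi> \<in> Ring.ring_hom B C \<and> \<pi> ` carrier B = carrier C \<and>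
    (\<forall>b\<in>carrier B. \<pi> b = \<zero>\<^bsub>C\<^esub> \<longleftrightarrow> (\<exists>b'\<in>carrier B. b = add_pow B p (b'))) \<and>
    (\<forall>b\<in>carrier B. add_pow B (p ^ r) b = \<zero>\<^bsub>B\<^esub>) \<and>
    (\<forall>b\<in>carrier B. add_pow B (p ^ (r - 1)) b = \<zero>\<^bsub>B\<^esub> \<longrightarrow> \<pi> b = \<zero>\<^bsub>C\<^esub>)"

section \<open>Finite direct products of lifts\<close>

lemma RDirProd_simps [simp]:
  "(a, b) \<oplus>\<^bsub>RDirProd R S\<^esub> (c, d) = (a \<oplus>\<^bsub>R\<^esub> c, b \<oplus>\<^bsub>S\<^esub> d)"
  "(a, b) \<otimes>\<^bsub>RDirProd R S\<^esub> (c, d) = (a \<otimes>\<^bsub>R\<^esub> c, b \<otimes>\<^bsub>S\<^esub> d)"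
  "\<zero>\<^bsub>RDirProd R S\<^esub> = (\<zero>\<^bsub>R\<^esub>, \<zero>\<^bsub>S\<^esub>)"
  "\<one>\<^bsub>RDirProd R S\<^esub> = (\<one>\<^bsub>R\<^esub>, \<one>\<^bsub>S\<^esub>)"
  by (simp_all add: RDirProd_def DirProd_def monoid.defs)

lemma add_pow_RDirProd:
  assumes "ring R" "ring S" "a \<in> carrier R" "b \<in> carrier S"
  shows "add_pow (RDirProd R S) (k::int) (a, b) = (add_pow R k a, add_pow S k b)"
proof -
  note rings = RDirProd_ring[OF assms(1,2), THEN ring.is_abelian_group]
    assms(1,2)[THEN ring.is_abelian_group]
  have "fst (add_pow (RDirProd R S) (k::int) (a, b)) = add_pow R k (fst (a, b))"
    by (rule add_pow_hom) (use rings assms in \<open>auto simp: RDirProd_carrier\<close>)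
  moreover have "snd (add_pow (RDirProd R S) (k::int) (a, b)) = add_pow S k (snd (a, b))"
    by (rule add_pow_hom) (use rings assms in \<open>auto simp: RDirProd_carrier\<close>)
  ultimately show ?thesis by (simp add: prod_eq_iff)
qed

lemma p_lift_RDirProd:
  assumes "p_lift p r B C f" "p_lift p r B' C' g"
  shows "p_lift p r (RDirProd B B') (RDirProd C C') (\<lambda>(x, y). (f x, g y))"
proof -
  have *: "f ` carrier B = carrier C" "g ` carrier B' = carrier C'" "ring B" "ring B'"
    using assms by (auto simp: p_lift_def)
  have "(\<lambda>(x, y). (f x, g y)) ` carrier (RDirProd B B') = carrier (RDirProd C C')"
    unfolding RDirProd_carrier *(1,2)[symmetric] by (auto simp: image_iff)
  moreover have "(\<lambda>(x, y). (f x, g y)) \<in> Ring.ring_hom (RDirProd B B') (RDirProd C C')"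
    using assms by (auto simp: p_lift_def intro!: RDirProd_hom3)
  ultimately show ?thesis using assms
    by (auto simp: p_lift_def RDirProd_ring RDirProd_carrier add_pow_RDirProd)
qed

text \<open>Needed because the elements of \<open>RDirProd_list\<close> are lists: the product over
  a nonempty list is only isomorphic to the product of its head with the product over its tail. Lift
  and reduction both change, so two isomorphisms enter.\<close>

lemma p_lift_iso:
  assumes "p_lift p r B C \<pi>" "f \<in> ring_iso B B'" "g \<in> ring_iso C C'" "ring B'" "ring C'"
  shows "p_lift p r B' C' (g \<circ> \<pi> \<circ> inv_into (carrier B) f)"
proof -
  note rings = assms(1)[unfolded p_lift_def] assms(4,5)
  interpret B: ring B using rings by simp
  interpret C: ring C using rings by simp
  interpret B': ring B' by fact
  interpret C': ring C' by fact
  let ?f = "inv_into (carrier B) f"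
  have f': "?f \<in> ring_iso B' B" using assms(2) B.ring_axioms ring_iso_set_sym by blast
  then have f'': "?f \<in> Ring.ring_hom B' B" "bij_betw ?f (carrier B') (carrier B)"
    by (auto simp: ring_iso_def)
  have g: "g \<in> Ring.ring_hom C C'" "bij_betw g (carrier C) (carrier C')"
    using assms by (auto simp: ring_iso_def)
  have f: "f \<in> Ring.ring_hom B B'" "bij_betw f (carrier B) (carrier B')"
    using assms by (auto simp: ring_iso_def)
  have ff: "f (?f x) = x" if "x \<in> carrier B'" for x
    using f(2) that by (auto simp: bij_betw_def f_inv_into_f)
  have hom: "g \<circ> \<pi> \<circ> ?f \<in> Ring.ring_hom B' C'"
    using ring_hom_trans[OF ring_hom_trans[OF f''(1)] g(1)] rings by (simp add: o_assoc)
  have c: "?f b \<in> carrier B" if "b \<in> carrier B'" for b using f''(1) that by (rule ring_hom_closed)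
  have fc: "f b \<in> carrier B'" if "b \<in> carrier B" for b using f(1) that by (rule ring_hom_closed)
  have pc: "\<pi> b \<in> carrier C" if "b \<in> carrier B" for b using rings that by (metis ring_hom_closed)
  have p: "?f (add_pow (B') (k::int) b) = add_pow B k (?f b)" if "b \<in> carrier B'" for k b
    by (rule add_pow_hom) (use f''(1) that in \<open>auto simp: B.abelian_group_axioms B'.abelian_group_axioms ring_hom_add c\<close>)
  have pf: "f (add_pow B (k::int) b) = add_pow (B') k (f b)" if "b \<in> carrier B" for k b
    by (rule add_pow_hom) (use f(1) that in \<open>auto simp: B.abelian_group_axioms B'.abelian_group_axioms ring_hom_add fc\<close>)
  have f0: "?f b = \<zero>\<^bsub>B\<^esub> \<longleftrightarrow> b = \<zero>\<^bsub>B'\<^esub>" if "b \<in> carrier B'" for b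
    using f''(2) that by (metis B.ring_axioms B'.ring_axioms B'.zero_closed bij_betw_def f''(1) inj_on_def ring_hom_zero)
  have g0: "g b = \<zero>\<^bsub>C'\<^esub> \<longleftrightarrow> b = \<zero>\<^bsub>C\<^esub>" if "b \<in> carrier C" for b
    using g(2) that by (metis C.ring_axioms C'.ring_axioms C.zero_closed bij_betw_def g(1) inj_on_def ring_hom_zero)
  have surj: "(g \<circ> \<pi> \<circ> ?f) ` carrier B' = carrier C'"
    unfolding image_comp[symmetric] using rings f''(2) g(2) by (simp add: bij_betw_def)
  have ker: "(g \<circ> \<pi> \<circ> ?f) b = \<zero>\<^bsub>C'\<^esub> \<longleftrightarrow> (\<exists>b'\<in>carrier B'. b = add_pow (B') p (b'))" if "b \<in> carrier B'" for b
  proof -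
    have "(g \<circ> \<pi> \<circ> ?f) b = \<zero>\<^bsub>C'\<^esub> \<longleftrightarrow> (\<exists>b'\<in>carrier B. ?f b = add_pow B p (b'))"
      using that rings by (simp add: g0 pc c)
    also have "\<dots> \<longleftrightarrow> (\<exists>b'\<in>carrier B'. b = add_pow (B') p (b'))"
      using that by (metis c fc ff p pf)
    finally show ?thesis .
  qed
  have tors: "(g \<circ> \<pi> \<circ> ?f) b = \<zero>\<^bsub>C'\<^esub>" if "b \<in> carrier B'" "add_pow (B') (p ^ (r-1)) b = \<zero>\<^bsub>B'\<^esub>" for b
  proof -
    have "add_pow B (p ^ (r-1)) (?f b) = \<zero>\<^bsub>B\<^esub>" using that f0 p[of b] by (metis B'.zero_closed)
    then show ?thesis using rings that by (auto simp: g0 pc c)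
  qed
  have ann: "add_pow (B') (p ^ r) b = \<zero>\<^bsub>B'\<^esub>" if "b \<in> carrier B'" for b
  proof -
    have "?f (add_pow (B') (p ^ r) b) = \<zero>\<^bsub>B\<^esub>" using that p[of b] rings c by simp
    then show ?thesis using that by (simp add: f0 B'.add.int_pow_closed)
  qed
  show ?thesis unfolding p_lift_def
    using rings hom surj ker tors ann by simp
qed

lemma nil_ring: "ring nil_ring"
  using RDirProd_list_is_ring[of "[]"] by simp

lemma add_pow_nil_ring: "add_pow nil_ring (k::int) [] = []"
proof -
  interpret ring nil_ring by (rule nil_ring)
  show ?thesis using add.int_pow_closed[of "[]" k] by (simp del: monoid.defs)
qed

lemma p_lift_RDirProd_list:
  fixes Rs :: "('a, 'm) ring_scheme list" and Ss :: "('c, 'n) ring_scheme list"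
  assumes "length Rs = length Ss"
    and "\<And>i. i < length Rs \<Longrightarrow> \<exists>\<pi>. p_lift p r (Rs ! i) (Ss ! i) \<pi>"
  shows "\<exists>\<pi>. p_lift p r (RDirProd_list Rs) (RDirProd_list Ss) \<pi>"
  using assms
proof (induction Rs Ss rule: list_induct2)
  case Nil
  \<comment> \<open>The empty product is the zero ring, where every clause of \<open>p_lift\<close>
    is trivial.\<close>
  have "p_lift p r (nil_ring :: 'a list ring) (nil_ring :: 'c list ring) (\<lambda>x. [])"
    unfolding p_lift_def
    by (simp add: nil_ring Ring.ring_hom_def add_pow_nil_ring del: monoid.defs) (simp add: monoid.defs)
  then show ?case by auto
next
  case (Cons R Rs S Ss)
  obtain \<pi>1 where 1: "p_lift p r R S \<pi>1" using Cons(3)[of 0] by auto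
  obtain \<pi>2 where 2: "p_lift p r (RDirProd_list Rs) (RDirProd_list Ss) \<pi>2"
    using Cons(2) Cons(3)[of "Suc _"] by auto
  have r: "ring (RDirProd_list (R # Rs))" "ring (RDirProd_list (S # Ss))"
    using Cons(1,3) by (auto intro!: RDirProd_list_is_ring simp: p_lift_def)
  from p_lift_iso[OF p_lift_RDirProd[OF 1 2] RDirProd_list_iso1 RDirProd_list_iso1 r]
  show ?case by blast
qed

section \<open>Matrix rings and their lifts\<close>

lemma matrix_ring_carrier:
  "A \<in> carrier (matrix_ring n R) \<longleftrightarrow>
    dim_row A = n \<and> dim_col A = n \<and> (\<forall>i<n. \<forall>j<n. A $$ (i, j) \<in> carrier R)"
  by (auto simp: matrix_ring_def)

lemma matrix_ring_ops:
  "A \<otimes>\<^bsub>matrix_ring n R\<^esub> B =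
    mat n n (\<lambda>(i, j). \<Oplus>\<^bsub>R\<^esub>l\<in>{..<n}. A $$ (i, l) \<otimes>\<^bsub>R\<^esub> B $$ (l, j))"
  "A \<oplus>\<^bsub>matrix_ring n R\<^esub> B = mat n n (\<lambda>(i, j). A $$ (i, j) \<oplus>\<^bsub>R\<^esub> B $$ (i, j))"
  "\<one>\<^bsub>matrix_ring n R\<^esub> = mat n n (\<lambda>(i, j). if i = j then \<one>\<^bsub>R\<^esub> else \<zero>\<^bsub>R\<^esub>)"
  "\<zero>\<^bsub>matrix_ring n R\<^esub> = mat n n (\<lambda>_. \<zero>\<^bsub>R\<^esub>)"
  by (simp_all add: matrix_ring_def)

context ring begin

lemma finsum_swap:
  assumes "finite A" "finite B" "\<And>i j. i \<in> A \<Longrightarrow> j \<in> B \<Longrightarrow> f i j \<in> carrier R"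
  shows "(\<Oplus>i\<in>A. \<Oplus>j\<in>B. f i j) = (\<Oplus>j\<in>B. \<Oplus>i\<in>A. f i j)"
  using assms
proof (induction A rule: finite_induct)
  case empty
  then show ?case by (simp add: add.finprod_one_eqI)
next
  case (insert x A)
  then have "(\<Oplus>i\<in>insert x A. \<Oplus>j\<in>B. f i j) = (\<Oplus>j\<in>B. f x j) \<oplus> (\<Oplus>j\<in>B. \<Oplus>i\<in>A. f i j)"
    by (simp add: finsum_insert finsum_closed Pi_def)
  also have "\<dots> = (\<Oplus>j\<in>B. f x j \<oplus> (\<Oplus>i\<in>A. f i j))"
    using insert by (subst finsum_addf) (auto simp: finsum_closed Pi_def)
  also have "\<dots> = (\<Oplus>j\<in>B. \<Oplus>i\<in>insert x A. f i j)"
    using insert by (intro finsum_cong') (auto simp: finsum_insert finsum_closed Pi_def)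
  finally show ?case .
qed

lemma finsum_delta:
  assumes "finite A" "a \<in> A" "f \<in> A \<rightarrow> carrier R"
  shows "(\<Oplus>i\<in>A. if i = a then f i else \<zero>) = f a"
proof -
  have "(\<lambda>i. if i = a then f i else \<zero>) = (\<lambda>i. if a = i then f i else \<zero>)" by auto
  then show ?thesis using add.finprod_singleton[OF assms(2,1,3)] by simp
qed

lemma ring_matrix_ring: "ring (matrix_ring n R)" (is "ring ?M")
proof (rule ringI)
  show "abelian_group ?M"
  proof (rule abelian_groupI)
    fix A assume "A \<in> carrier ?M"
    then show "\<exists>B\<in>carrier ?M. B \<oplus>\<^bsub>?M\<^esub> A = \<zero>\<^bsub>?M\<^esub>"
      by (intro bexI[of _ "mat n n (\<lambda>(i, j). \<ominus> (A $$ (i, j)))"])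
        (auto simp: matrix_ring_carrier matrix_ring_ops l_neg)
  qed (auto simp: matrix_ring_carrier matrix_ring_ops a_ac)
  show "Group.monoid ?M"
  proof (rule monoidI)
    fix A B C assume A: "A \<in> carrier ?M" and B: "B \<in> carrier ?M" and C: "C \<in> carrier ?M"
    show "A \<otimes>\<^bsub>?M\<^esub> B \<otimes>\<^bsub>?M\<^esub> C = A \<otimes>\<^bsub>?M\<^esub> (B \<otimes>\<^bsub>?M\<^esub> C)"
    proof (rule eq_matI)
      fix i j
      assume "i < dim_row (A \<otimes>\<^bsub>?M\<^esub> (B \<otimes>\<^bsub>?M\<^esub> C))" "j < dim_col (A \<otimes>\<^bsub>?M\<^esub> (B \<otimes>\<^bsub>?M\<^esub> C))"
      then have ij: "i < n" "j < n" by (simp_all add: matrix_ring_ops)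
      have a: "A $$ (i, l) \<in> carrier R" "B $$ (l, l') \<in> carrier R" "C $$ (l', j) \<in> carrier R"
        if "l < n" "l' < n" for l l'
        using A B C ij that by (auto simp: matrix_ring_carrier)
      have "(A \<otimes>\<^bsub>?M\<^esub> B \<otimes>\<^bsub>?M\<^esub> C) $$ (i, j)
          = (\<Oplus>l'\<in>{..<n}. (\<Oplus>l\<in>{..<n}. A $$ (i, l) \<otimes> B $$ (l, l')) \<otimes> C $$ (l', j))"
        using ij by (simp add: matrix_ring_ops) (intro finsum_cong', auto simp: a intro!: finsum_closed)
      also have "\<dots> = (\<Oplus>l'\<in>{..<n}. \<Oplus>l\<in>{..<n}. A $$ (i, l) \<otimes> B $$ (l, l') \<otimes> C $$ (l', j))"
        by (intro finsum_cong') (auto simp: a finsum_ldistr intro!: finsum_closed)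
      also have "\<dots> = (\<Oplus>l\<in>{..<n}. \<Oplus>l'\<in>{..<n}. A $$ (i, l) \<otimes> B $$ (l, l') \<otimes> C $$ (l', j))"
        by (rule finsum_swap) (auto simp: a)
      also have "\<dots> = (\<Oplus>l\<in>{..<n}. A $$ (i, l) \<otimes> (\<Oplus>l'\<in>{..<n}. B $$ (l, l') \<otimes> C $$ (l', j)))"
        by (intro finsum_cong') (auto simp: a finsum_rdistr m_assoc intro!: finsum_closed finsum_cong')
      also have "\<dots> = (A \<otimes>\<^bsub>?M\<^esub> (B \<otimes>\<^bsub>?M\<^esub> C)) $$ (i, j)"
        using ij by (simp add: matrix_ring_ops) (intro finsum_cong', auto simp: a intro!: finsum_closed)
      finally show "(A \<otimes>\<^bsub>?M\<^esub> B \<otimes>\<^bsub>?M\<^esub> C) $$ (i, j) = (A \<otimes>\<^bsub>?M\<^esub> (B \<otimes>\<^bsub>?M\<^esub> C)) $$ (i, j)" .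
    qed (simp_all add: matrix_ring_ops)
  next
    fix A assume A: "A \<in> carrier ?M"
    show "\<one>\<^bsub>?M\<^esub> \<otimes>\<^bsub>?M\<^esub> A = A"
    proof (rule eq_matI)
      fix i j assume "i < dim_row A" "j < dim_col A"
      then have ij: "i < n" "j < n" using A by (auto simp: matrix_ring_carrier)
      have "(\<one>\<^bsub>?M\<^esub> \<otimes>\<^bsub>?M\<^esub> A) $$ (i, j) = (\<Oplus>l\<in>{..<n}. if l = i then A $$ (l, j) else \<zero>)"
        using A ij by (simp add: matrix_ring_ops) (intro finsum_cong', auto simp: matrix_ring_carrier)
      also have "\<dots> = A $$ (i, j)"
        using A ij by (subst finsum_delta) (auto simp: matrix_ring_carrier)
      finally show "(\<one>\<^bsub>?M\<^esub> \<otimes>\<^bsub>?M\<^esub> A) $$ (i, j) = A $$ (i, j)" .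
    qed (use A in \<open>auto simp: matrix_ring_ops matrix_ring_carrier\<close>)
    show "A \<otimes>\<^bsub>?M\<^esub> \<one>\<^bsub>?M\<^esub> = A"
    proof (rule eq_matI)
      fix i j assume "i < dim_row A" "j < dim_col A"
      then have ij: "i < n" "j < n" using A by (auto simp: matrix_ring_carrier)
      have "(A \<otimes>\<^bsub>?M\<^esub> \<one>\<^bsub>?M\<^esub>) $$ (i, j) = (\<Oplus>l\<in>{..<n}. if l = j then A $$ (i, l) else \<zero>)"
        using A ij by (simp add: matrix_ring_ops) (intro finsum_cong', auto simp: matrix_ring_carrier)
      also have "\<dots> = A $$ (i, j)"
        using A ij by (subst finsum_delta) (auto simp: matrix_ring_carrier)
      finally show "(A \<otimes>\<^bsub>?M\<^esub> \<one>\<^bsub>?M\<^esub>) $$ (i, j) = A $$ (i, j)" .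
    qed (use A in \<open>auto simp: matrix_ring_ops matrix_ring_carrier\<close>)
  qed (auto simp: matrix_ring_carrier matrix_ring_ops intro!: finsum_closed)
next
  fix A B C assume ABC: "A \<in> carrier ?M" "B \<in> carrier ?M" "C \<in> carrier ?M"
  then have a: "A $$ (i, j) \<in> carrier R" "B $$ (i, j) \<in> carrier R" "C $$ (i, j) \<in> carrier R"
    if "i < n" "j < n" for i j
    using that by (auto simp: matrix_ring_carrier)
  show "(A \<oplus>\<^bsub>?M\<^esub> B) \<otimes>\<^bsub>?M\<^esub> C = A \<otimes>\<^bsub>?M\<^esub> C \<oplus>\<^bsub>?M\<^esub> B \<otimes>\<^bsub>?M\<^esub> C"
    by (rule eq_matI) (auto simp: matrix_ring_ops a l_distr simp flip: finsum_addf
        intro!: finsum_cong' finsum_closed)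
  show "C \<otimes>\<^bsub>?M\<^esub> (A \<oplus>\<^bsub>?M\<^esub> B) = C \<otimes>\<^bsub>?M\<^esub> A \<oplus>\<^bsub>?M\<^esub> C \<otimes>\<^bsub>?M\<^esub> B"
    by (rule eq_matI) (auto simp: matrix_ring_ops a r_distr simp flip: finsum_addf
        intro!: finsum_cong' finsum_closed)
qed

lemma add_pow_matrix_ring:
  assumes "A \<in> carrier (matrix_ring n R)" "i < n" "j < n"
  shows "add_pow (matrix_ring n R) (k::int) A $$ (i, j) = add_pow R k (A $$ (i, j))"
  by (rule add_pow_hom[where f = "\<lambda>A. A $$ (i, j)"])
    (use assms ring.is_abelian_group[OF ring_matrix_ring] abelian_group_axioms in
      \<open>auto simp: matrix_ring_carrier matrix_ring_ops\<close>)

end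

text \<open>Integer multiples act entrywise, and a matrix maps to zero exactly if all its entries
  do, so the kernel, annihilation and torsion clauses are tested one entry at a time. Only the
  homomorphism property involves sums of products.\<close>

lemma p_lift_matrix_ring:
  assumes "p_lift p r R S f"
  shows "p_lift p r (matrix_ring n R) (matrix_ring n S) (map_mat f)"
proof -
  note fl = assms[unfolded p_lift_def]
  interpret R: ring R using fl by simp
  interpret S: ring S using fl by simp
  let ?R = "matrix_ring n R" and ?S = "matrix_ring n S"
  interpret MR: ring ?R by (rule R.ring_matrix_ring)
  interpret MS: ring ?S by (rule S.ring_matrix_ring)
  have f: "f \<in> Ring.ring_hom R S" using fl by simp
  have fc: "f x \<in> carrier S" if "x \<in> carrier R" for x using f that by (rule ring_hom_closed)
  have pow: "add_pow ?R (k::int) A \<in> carrier ?R" "dim_row (add_pow ?R k A) = n" "dim_col (add_pow ?R k A) = n"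
    if "A \<in> carrier ?R" for k A
    using MR.add.int_pow_closed[OF that, of k] by (auto simp: matrix_ring_carrier)
  have eqI: "A = B" if "A \<in> carrier (matrix_ring n T)" "B \<in> carrier (matrix_ring n T)"
    "\<And>i j. i < n \<Longrightarrow> j < n \<Longrightarrow> A $$ (i, j) = B $$ (i, j)"
    for A B :: "'x mat" and T :: "('x, 'y) ring_scheme"
    using that by (intro eq_matI) (auto simp: matrix_ring_carrier)
  have hom: "map_mat f \<in> Ring.ring_hom ?R ?S"
  proof (rule ring_hom_memI)
    fix A B assume A: "A \<in> carrier ?R" and B: "B \<in> carrier ?R"
    then show "map_mat f A \<in> carrier ?S" "map_mat f (A \<oplus>\<^bsub>?R\<^esub> B) = map_mat f A \<oplus>\<^bsub>?S\<^esub> map_mat f B"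
      by (auto simp: matrix_ring_carrier matrix_ring_ops fc ring_hom_add[OF f])
    have a: "A $$ (i, j) \<in> carrier R" "B $$ (i, j) \<in> carrier R" if "i < n" "j < n" for i j
      using A B that by (auto simp: matrix_ring_carrier)
    have "f (\<Oplus>\<^bsub>R\<^esub>l\<in>{..<n}. A $$ (i, l) \<otimes>\<^bsub>R\<^esub> B $$ (l, j)) =
      (\<Oplus>\<^bsub>S\<^esub>l\<in>{..<n}. f (A $$ (i, l)) \<otimes>\<^bsub>S\<^esub> f (B $$ (l, j)))" if "i < n" "j < n" for i j
      by (subst finsum_hom[OF R.abelian_group_axioms S.abelian_group_axioms])
        (use that in \<open>auto simp: fc a ring_hom_add[OF f] ring_hom_mult[OF f] intro!: S.finsum_cong'\<close>)
    then show "map_mat f (A \<otimes>\<^bsub>?R\<^esub> B) = map_mat f A \<otimes>\<^bsub>?S\<^esub> map_mat f B"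
      using A B by (intro eq_matI)
        (auto simp: matrix_ring_carrier matrix_ring_ops a fc intro!: S.finsum_cong')
  next
    show "map_mat f \<one>\<^bsub>?R\<^esub> = \<one>\<^bsub>?S\<^esub>"
      by (auto simp: matrix_ring_ops ring_hom_one[OF f] ring_hom_zero[OF f R.ring_axioms S.ring_axioms])
  qed
  have surj: "map_mat f ` carrier ?R = carrier ?S"
  proof
    show "map_mat f ` carrier ?R \<subseteq> carrier ?S" using hom by (auto simp: Ring.ring_hom_def)
    show "carrier ?S \<subseteq> map_mat f ` carrier ?R"
    proof
      fix B assume B: "B \<in> carrier ?S"
      let ?A = "mat n n (\<lambda>ij. inv_into (carrier R) f (B $$ ij))"
      have c: "B $$ (i, j) \<in> f ` carrier R" if "i < n" "j < n" for i j
        using fl B that by (auto simp: matrix_ring_carrier)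
      have "?A \<in> carrier ?R" using c by (auto simp: matrix_ring_carrier inv_into_into)
      moreover have "map_mat f ?A = B"
        using B c by (auto simp: matrix_ring_carrier f_inv_into_f)
      ultimately show "B \<in> map_mat f ` carrier ?R" by (metis imageI)
    qed
  qed
  have zero_iff: "map_mat f A = \<zero>\<^bsub>?S\<^esub> \<longleftrightarrow> (\<forall>i<n. \<forall>j<n. f (A $$ (i, j)) = \<zero>\<^bsub>S\<^esub>)"
    if "A \<in> carrier ?R" for A
    using that by (auto simp: matrix_ring_ops matrix_ring_carrier mat_eq_iff)
  have ker: "map_mat f A = \<zero>\<^bsub>?S\<^esub> \<longleftrightarrow> (\<exists>B\<in>carrier ?R. A = add_pow ?R p B)" if A: "A \<in> carrier ?R" for A
  proof
    assume "map_mat f A = \<zero>\<^bsub>?S\<^esub>"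
    then have "\<forall>i<n. \<forall>j<n. \<exists>b\<in>carrier R. A $$ (i, j) = add_pow R p b"
      using A fl by (auto simp: zero_iff matrix_ring_carrier)
    then obtain b where b: "\<And>i j. i < n \<Longrightarrow> j < n \<Longrightarrow> b i j \<in> carrier R \<and> A $$ (i, j) = add_pow R p (b i j)"
      by metis
    have B: "mat n n (\<lambda>(i, j). b i j) \<in> carrier ?R" using b by (auto simp: matrix_ring_carrier)
    moreover have "A = add_pow ?R p (mat n n (\<lambda>(i, j). b i j))"
      by (rule eqI[OF A pow(1)[OF B]]) (simp add: R.add_pow_matrix_ring[OF B] b)
    ultimately show "\<exists>B\<in>carrier ?R. A = add_pow ?R p B" by blast
  next
    assume "\<exists>B\<in>carrier ?R. A = add_pow ?R p B"
    then obtain B where B: "B \<in> carrier ?R" "A = add_pow ?R p B" by blast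
    have "\<exists>b\<in>carrier R. A $$ (i, j) = add_pow R p b" if "i < n" "j < n" for i j
      using that B R.add_pow_matrix_ring[OF B(1) that, of p] by (auto simp: matrix_ring_carrier)
    then show "map_mat f A = \<zero>\<^bsub>?S\<^esub>" unfolding zero_iff[OF A]
      using fl A by (auto simp: matrix_ring_carrier)
  qed
  have ann: "add_pow ?R (p ^ r) A = \<zero>\<^bsub>?R\<^esub>" if A: "A \<in> carrier ?R" for A
    by (rule eqI[OF pow(1)[OF A] MR.zero_closed])
      (use A fl in \<open>auto simp: R.add_pow_matrix_ring[OF A] matrix_ring_ops matrix_ring_carrier\<close>)
  have tors: "map_mat f A = \<zero>\<^bsub>?S\<^esub>"
    if A: "A \<in> carrier ?R" and 0: "add_pow ?R (p ^ (r - 1)) A = \<zero>\<^bsub>?R\<^esub>" for A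
  proof -
    have "add_pow R (p ^ (r - 1)) (A $$ (i, j)) = \<zero>\<^bsub>R\<^esub>" if "i < n" "j < n" for i j
      using R.add_pow_matrix_ring[OF A that, of "p ^ (r - 1)"] that
      by (simp only: 0) (simp add: matrix_ring_ops)
    then show ?thesis unfolding zero_iff[OF A]
      using fl A by (auto simp: matrix_ring_carrier)
  qed
  show ?thesis unfolding p_lift_def
    using MR.ring_axioms MS.ring_axioms hom surj ker ann tors by blast
qed

section \<open>Lifting the group\<close>

lemma add_pow_int_0 [simp]: "add_pow R (0::int) a = \<zero>\<^bsub>R\<^esub>"
  by (simp add: add_pow_def)

text \<open>With \<open>A = \<phi> a\<close>, \<open>B = \<phi> b\<close>, \<open>H = \<phi> h\<close>, \<open>U = \<phi> (h\<^sup>-\<^sup>1)\<close>, \<open>V = \<phi> ((b h)\<^sup>-\<^sup>1)\<close> this is the cocycle identity for the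
  defect \<open>\<phi> x \<cdot> \<phi> y - \<phi> (x y)\<close>; the last bracket is quadratic in defects.\<close>

lemma (in ring) defect_identity:
  assumes "A \<in> carrier R" "B \<in> carrier R" "H \<in> carrier R" "U \<in> carrier R"
    "AB \<in> carrier R" "BH \<in> carrier R" "ABH \<in> carrier R" "V \<in> carrier R"
  shows "A \<otimes> ((B \<otimes> H \<ominus> BH) \<otimes> U) \<oplus> (A \<otimes> BH \<ominus> ABH) \<otimes> V \<otimes> B =
    (AB \<otimes> H \<ominus> ABH) \<otimes> U \<oplus> (A \<otimes> B \<ominus> AB) \<oplus>
    ((A \<otimes> B \<ominus> AB) \<otimes> (H \<otimes> U \<ominus> \<one>) \<oplus> (A \<otimes> BH \<ominus> ABH) \<otimes> (V \<otimes> B \<ominus> U))"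
  using assms unfolding a_minus_def by (algebra, simp, algebra)

text \<open>This is the two-sided ideal kR. Membership for \<open>k = p ^ s\<close> replaces
  equality in the quotient by that ideal, so approximately multiplicative maps keep their values in
  the ring itself and no quotients by varying powers of \<open>p\<close> occur.\<close>

definition (in ring) multiples :: "int \<Rightarrow> 'a set" where
  "multiples k = (\<lambda>a. add_pow R k a) ` carrier R"

context ring begin

lemma multiples_closed: "x \<in> multiples k \<Longrightarrow> x \<in> carrier R"
  by (auto simp: multiples_def)

lemma multiples_zero: "\<zero> \<in> multiples k"
  unfolding multiples_def by (rule image_eqI[of _ _ \<zero>]) simp_all

lemma multiples_add: "x \<in> multiples k \<Longrightarrow> y \<in> multiples k \<Longrightarrow> x \<oplus> y \<in> multiples k"
  by (auto simp: multiples_def add.int_pow_distrib[symmetric] intro!: imageI)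

lemma multiples_neg: "x \<in> multiples k \<Longrightarrow> \<ominus> x \<in> multiples k"
  by (auto simp: multiples_def add.int_pow_inv[symmetric] intro!: imageI)

text \<open>This is where progress comes from: a product of two defects in
  \<open>multiples k\<close> lands in \<open>multiples (k * k)\<close>, so whatever is quadratic in
  defects may be neglected.\<close>

lemma multiples_mult: "x \<in> multiples k \<Longrightarrow> y \<in> multiples l \<Longrightarrow> x \<otimes> y \<in> multiples (k * l)"
  by (auto simp: multiples_def add_pow_ldistr_int add_pow_rdistr_int add.int_pow_pow mult.commute
      intro!: imageI)

lemma multiples_one: "x \<in> carrier R \<Longrightarrow> x \<in> multiples 1"
  unfolding multiples_def by (rule image_eqI[of _ _ x]) simp_all

lemma multiples_mult_l: "x \<in> multiples k \<Longrightarrow> y \<in> carrier R \<Longrightarrow> x \<otimes> y \<in> multiples k"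
  using multiples_mult[OF _ multiples_one] by simp

lemma multiples_dvd: "x \<in> multiples k \<Longrightarrow> l dvd k \<Longrightarrow> x \<in> multiples l"
  by (auto simp: multiples_def dvd_def add.int_pow_pow[symmetric] mult.commute intro!: imageI)

lemma multiples_add_pow: "x \<in> multiples k \<Longrightarrow> add_pow R (l::int) x \<in> multiples k"
  by (auto simp: multiples_def add.int_pow_pow mult.commute[of k])
    (metis add.int_pow_closed add.int_pow_pow image_eqI)

lemma multiples_finsum: "(\<And>i. i \<in> A \<Longrightarrow> f i \<in> multiples k) \<Longrightarrow> (\<Oplus>i\<in>A. f i) \<in> multiples k"
proof (induction A rule: infinite_finite_induct)
  case (insert x A)
  then have "f \<in> A \<rightarrow> carrier R" "f x \<in> carrier R" using multiples_closed by auto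
  then show ?case using insert by (auto intro!: multiples_add)
qed (simp_all add: multiples_zero)

end

text \<open>The correction \<open>d a\<close> averages \<open>- \<delta> a h \<cdot> \<phi> (h\<^sup>-\<^sup>1)\<close> over \<open>h\<close>, where \<open>N\<close> is an inverse of the group order;
  its coboundary cancels the defect \<open>\<delta>\<close> up to products of two defects.\<close>

lemma (in ring) improve_multiplicativity:
  fixes G :: "('g, 't) monoid_scheme" (structure)
  assumes G: "group G" "finite (carrier G)"
    and \<phi>: "\<phi> \<in> carrier G \<rightarrow> carrier R" "\<phi> \<one>\<^bsub>G\<^esub> = \<one>"
    and N: "\<And>b. b \<in> carrier R \<Longrightarrow> add_pow R (N * int (order G)) b = b"
    and c: "\<And>a b. a \<in> carrier G \<Longrightarrow> b \<in> carrier G \<Longrightarrow>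
      \<phi> a \<otimes> \<phi> b \<ominus> \<phi> (a \<otimes>\<^bsub>G\<^esub> b) \<in> multiples k"
  shows "\<exists>\<phi>'. \<phi>' \<in> carrier G \<rightarrow> carrier R \<and> \<phi>' \<one>\<^bsub>G\<^esub> = \<one> \<and>
    (\<forall>a\<in>carrier G. \<phi>' a \<ominus> \<phi> a \<in> multiples k) \<and>
    (\<forall>a\<in>carrier G. \<forall>b\<in>carrier G. \<phi>' a \<otimes> \<phi>' b \<ominus> \<phi>' (a \<otimes>\<^bsub>G\<^esub> b) \<in> multiples (k * k))"
proof -
  interpret G: group G by fact
  define \<delta> where "\<delta> a b = \<phi> a \<otimes> \<phi> b \<ominus> \<phi> (a \<otimes>\<^bsub>G\<^esub> b)" for a b
  define S where "S a = (\<Oplus>h\<in>carrier G. \<delta> a h \<otimes> \<phi> (inv\<^bsub>G\<^esub> h))" for a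
  \<comment> \<open>The last bracket of \<open>defect_identity\<close>. There
    \<open>H \<otimes> U \<ominus> \<one>\<close> is the defect of \<open>h\<close> and its inverse
    because \<phi> fixes the unit, and \<open>V \<otimes> B \<ominus> U\<close> is a defect because
    the inverse of \<open>b h\<close>, times \<open>b\<close>, is the inverse of
    \<open>h\<close>.\<close>
  define E where "E a b h = \<delta> a b \<otimes> \<delta> h (inv\<^bsub>G\<^esub> h) \<oplus>
    \<delta> a (b \<otimes>\<^bsub>G\<^esub> h) \<otimes> \<delta> (inv\<^bsub>G\<^esub> (b \<otimes>\<^bsub>G\<^esub> h)) b" for a b h
  define d where "d a = \<ominus> add_pow R N (S a)" for a
  have phi [simp, intro]: "\<phi> a \<in> carrier R" if "a \<in> carrier G" for a using \<phi> that by auto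
  have del [simp, intro]: "\<delta> a b \<in> carrier R" if "a \<in> carrier G" "b \<in> carrier G" for a b
    using that by (simp add: \<delta>_def)
  have delk: "\<delta> a b \<in> multiples k" if "a \<in> carrier G" "b \<in> carrier G" for a b
    using c that by (simp add: \<delta>_def)
  have Sk: "S a \<in> multiples k" if "a \<in> carrier G" for a
    unfolding S_def using that by (intro multiples_finsum multiples_mult_l delk) auto
  have S [simp, intro]: "S a \<in> carrier R" if "a \<in> carrier G" for a
    using Sk[OF that] multiples_closed by blast
  have Ek: "E a b h \<in> multiples (k * k)" if "a \<in> carrier G" "b \<in> carrier G" "h \<in> carrier G" for a b h
    unfolding E_def using that by (intro multiples_add multiples_mult delk) auto
  have E [simp, intro]: "E a b h \<in> carrier R" if "a \<in> carrier G" "b \<in> carrier G" "h \<in> carrier G" for a b h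
    using Ek[OF that] multiples_closed by blast
  have dk: "d a \<in> multiples k" if "a \<in> carrier G" for a
    unfolding d_def using Sk[OF that] by (intro multiples_neg multiples_add_pow)
  have d [simp, intro]: "d a \<in> carrier R" if "a \<in> carrier G" for a
    using dk[OF that] multiples_closed by blast
  \<comment> \<open>This is \<open>defect_identity\<close> summed over \<open>h\<close>. The terms
    of \<open>S a\<close> occur with \<open>b h\<close> in place of \<open>h\<close>, which runs
    over the whole group as well; \<open>\<delta> a b\<close> does not depend on \<open>h\<close>
    and is therefore collected \<open>order G\<close> times.\<close>
  have S_eq: "\<phi> a \<otimes> S b \<oplus> S a \<otimes> \<phi> b =
      S (a \<otimes>\<^bsub>G\<^esub> b) \<oplus> add_pow R (int (order G)) (\<delta> a b) \<oplus> (\<Oplus>h\<in>carrier G. E a b h)"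
    if a: "a \<in> carrier G" and b: "b \<in> carrier G" for a b
  proof -
    have bij: "(\<lambda>h. b \<otimes>\<^bsub>G\<^esub> h) ` carrier G = carrier G" "inj_on (\<lambda>h. b \<otimes>\<^bsub>G\<^esub> h) (carrier G)"
      using b by (auto simp: G.surj_const_mult G.inj_on_cmult)
    have "S a = (\<Oplus>h\<in>(\<lambda>h. b \<otimes>\<^bsub>G\<^esub> h) ` carrier G. \<delta> a h \<otimes> \<phi> (inv\<^bsub>G\<^esub> h))"
      by (simp add: S_def bij)
    also have "\<dots> = (\<Oplus>h\<in>carrier G. \<delta> a (b \<otimes>\<^bsub>G\<^esub> h) \<otimes> \<phi> (inv\<^bsub>G\<^esub> (b \<otimes>\<^bsub>G\<^esub> h)))"
      by (rule add.finprod_reindex) (use a b bij in auto)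
    finally have "S a \<otimes> \<phi> b = (\<Oplus>h\<in>carrier G. \<delta> a (b \<otimes>\<^bsub>G\<^esub> h) \<otimes> \<phi> (inv\<^bsub>G\<^esub> (b \<otimes>\<^bsub>G\<^esub> h)) \<otimes> \<phi> b)"
      using a b G(2) by (simp add: finsum_ldistr Pi_def)
    moreover have "\<phi> a \<otimes> S b = (\<Oplus>h\<in>carrier G. \<phi> a \<otimes> (\<delta> b h \<otimes> \<phi> (inv\<^bsub>G\<^esub> h)))"
      using a b G(2) by (simp add: S_def finsum_rdistr Pi_def)
    ultimately have "\<phi> a \<otimes> S b \<oplus> S a \<otimes> \<phi> b = (\<Oplus>h\<in>carrier G. \<phi> a \<otimes> (\<delta> b h \<otimes> \<phi> (inv\<^bsub>G\<^esub> h)) \<oplus>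
        \<delta> a (b \<otimes>\<^bsub>G\<^esub> h) \<otimes> \<phi> (inv\<^bsub>G\<^esub> (b \<otimes>\<^bsub>G\<^esub> h)) \<otimes> \<phi> b)"
      using a b by (simp add: finsum_addf Pi_def)
    also have "\<dots> = (\<Oplus>h\<in>carrier G. \<delta> (a \<otimes>\<^bsub>G\<^esub> b) h \<otimes> \<phi> (inv\<^bsub>G\<^esub> h) \<oplus> \<delta> a b \<oplus> E a b h)"
    proof (rule finsum_cong')
      fix h assume h: "h \<in> carrier G"
      have [simp]: "inv\<^bsub>G\<^esub> (b \<otimes>\<^bsub>G\<^esub> h) \<otimes>\<^bsub>G\<^esub> b = inv\<^bsub>G\<^esub> h"
        using b h by (simp add: G.inv_mult_group G.m_assoc)
      show "\<phi> a \<otimes> (\<delta> b h \<otimes> \<phi> (inv\<^bsub>G\<^esub> h)) \<oplus>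
        \<delta> a (b \<otimes>\<^bsub>G\<^esub> h) \<otimes> \<phi> (inv\<^bsub>G\<^esub> (b \<otimes>\<^bsub>G\<^esub> h)) \<otimes> \<phi> b =
        \<delta> (a \<otimes>\<^bsub>G\<^esub> b) h \<otimes> \<phi> (inv\<^bsub>G\<^esub> h) \<oplus> \<delta> a b \<oplus> E a b h"
        unfolding \<delta>_def E_def using a b h
          defect_identity[of "\<phi> a" "\<phi> b" "\<phi> h" "\<phi> (inv\<^bsub>G\<^esub> h)" "\<phi> (a \<otimes>\<^bsub>G\<^esub> b)" "\<phi> (b \<otimes>\<^bsub>G\<^esub> h)"
            "\<phi> (a \<otimes>\<^bsub>G\<^esub> (b \<otimes>\<^bsub>G\<^esub> h))" "\<phi> (inv\<^bsub>G\<^esub> (b \<otimes>\<^bsub>G\<^esub> h))"]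
        by (simp add: G.m_assoc \<phi>(2))
    qed (use a b in auto)
    also have "\<dots> = S (a \<otimes>\<^bsub>G\<^esub> b) \<oplus> (\<Oplus>h\<in>carrier G. \<delta> a b) \<oplus> (\<Oplus>h\<in>carrier G. E a b h)"
      using a b by (simp add: S_def finsum_addf Pi_def)
    also have "(\<Oplus>h\<in>carrier G. \<delta> a b) = add_pow R (int (order G)) (\<delta> a b)"
      using add.finprod_const[of "\<delta> a b" "carrier G"] a b
      by (simp add: order_def add_pow_int_ge)
    finally show ?thesis .
  qed
  \<comment> \<open>The left side is the defect of the corrected map without its term
    \<open>d a \<otimes> d b\<close>. As \<open>N * order G\<close> acts as the identity, the
    collected copies of \<open>\<delta> a b\<close> cancel the old defect and only quadratic terms
    remain.\<close>
  have d_eq: "\<phi> a \<otimes> d b \<oplus> d a \<otimes> \<phi> b \<oplus> \<delta> a b \<ominus> d (a \<otimes>\<^bsub>G\<^esub> b) =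
      \<ominus> add_pow R N (\<Oplus>h\<in>carrier G. E a b h)"
    if a: "a \<in> carrier G" and b: "b \<in> carrier G" for a b
  proof -
    have sE: "(\<Oplus>h\<in>carrier G. E a b h) \<in> carrier R" using a b by (auto intro!: finsum_closed)
    have "\<phi> a \<otimes> d b \<oplus> d a \<otimes> \<phi> b = \<ominus> add_pow R N (\<phi> a \<otimes> S b \<oplus> S a \<otimes> \<phi> b)"
      using a b by (simp add: d_def add_pow_ldistr_int add_pow_rdistr_int add.int_pow_distrib
          l_minus r_minus minus_add)
    also have "\<dots> = \<ominus> add_pow R N (S (a \<otimes>\<^bsub>G\<^esub> b)) \<ominus> \<delta> a b \<ominus> add_pow R N (\<Oplus>h\<in>carrier G. E a b h)"
      using a b sE N[of "\<delta> a b"] unfolding S_eq[OF a b]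
      by (simp add: add.int_pow_distrib add.int_pow_pow minus_add a_minus_def mult.commute)
    finally have "\<phi> a \<otimes> d b \<oplus> d a \<otimes> \<phi> b =
      d (a \<otimes>\<^bsub>G\<^esub> b) \<ominus> \<delta> a b \<ominus> add_pow R N (\<Oplus>h\<in>carrier G. E a b h)" by (simp add: d_def)
    moreover have "x \<ominus> y \<ominus> z \<oplus> y \<ominus> x = \<ominus> z"
      if "x \<in> carrier R" "y \<in> carrier R" "z \<in> carrier R" for x y z
      using that unfolding a_minus_def by algebra
    ultimately show ?thesis using a b sE by simp
  qed
  \<comment> \<open>The unit is kept because the defect vanishes when its first argument is the
    unit; the next round of improvement relies on this.\<close>
  have d1: "d \<one>\<^bsub>G\<^esub> = \<zero>"
  proof -
    have "S \<one>\<^bsub>G\<^esub> = (\<Oplus>h\<in>carrier G. \<zero>)"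
      unfolding S_def by (rule finsum_cong') (auto simp: \<delta>_def \<phi> a_minus_def r_neg)
    then show ?thesis by (simp add: d_def)
  qed
  have "(\<phi> a \<oplus> d a) \<otimes> (\<phi> b \<oplus> d b) \<ominus> (\<phi> (a \<otimes>\<^bsub>G\<^esub> b) \<oplus> d (a \<otimes>\<^bsub>G\<^esub> b)) \<in> multiples (k * k)"
    if a: "a \<in> carrier G" and b: "b \<in> carrier G" for a b
  proof -
    have "(x \<oplus> x') \<otimes> (y \<oplus> y') \<ominus> (z \<oplus> z') = (x \<otimes> y' \<oplus> x' \<otimes> y \<oplus> (x \<otimes> y \<ominus> z) \<ominus> z') \<oplus> x' \<otimes> y'"
      if "x \<in> carrier R" "y \<in> carrier R" "z \<in> carrier R" "x' \<in> carrier R" "y' \<in> carrier R" "z' \<in> carrier R"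
      for x x' y y' z z'
      using that unfolding a_minus_def by algebra
    then have "(\<phi> a \<oplus> d a) \<otimes> (\<phi> b \<oplus> d b) \<ominus> (\<phi> (a \<otimes>\<^bsub>G\<^esub> b) \<oplus> d (a \<otimes>\<^bsub>G\<^esub> b)) =
      \<ominus> add_pow R N (\<Oplus>h\<in>carrier G. E a b h) \<oplus> d a \<otimes> d b"
      using a b by (simp add: d_eq[symmetric] \<delta>_def[symmetric])
    also have "\<dots> \<in> multiples (k * k)"
      using a b by (intro multiples_add multiples_neg multiples_add_pow multiples_finsum Ek multiples_mult dk)
    finally show ?thesis .
  qed
  moreover have "\<phi> a \<oplus> d a \<ominus> \<phi> a = d a" if "a \<in> carrier G" for a
  proof -
    have "x \<oplus> y \<ominus> x = y" if "x \<in> carrier R" "y \<in> carrier R" for x y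
      using that unfolding a_minus_def by algebra
    then show ?thesis using that by simp
  qed
  ultimately show ?thesis
    by (intro exI[of _ "\<lambda>a. \<phi> a \<oplus> d a"]) (auto simp: dk d1 \<phi>)
qed

section \<open>Group rings over the integers modulo q\<close>

lemma finsum_residue_ring:
  assumes "m > 1" "finite A" "f \<in> A \<rightarrow> {0..m - 1}"
  shows "(\<Oplus>\<^bsub>residue_ring m\<^esub>i\<in>A. f i) = (\<Sum>i\<in>A. f i) mod m"
proof -
  interpret residues m "residue_ring m" using assms(1) by unfold_locales simp
  show ?thesis using assms(2,3)
  proof (induction A rule: finite_induct)
    case (insert x A)
    then have "f \<in> A \<rightarrow> carrier (residue_ring m)" "f x \<in> carrier (residue_ring m)"
      by (auto simp: residue_ring_def)
    with insert show ?case by (simp add: finsum_insert res_add_eq mod_simps)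
  qed (simp add: res_zero_eq)
qed

text \<open>Residue ring operations become integer operations with one final remainder, so that
  elements of the group ring can serve directly as integer coefficients for
  \<open>add_pow\<close>.\<close>

lemma group_ring_Zmod_simps:
  fixes G :: "('g, 't) monoid_scheme" (structure)
  assumes "group G" "finite (carrier G)" "q > 1"
  shows "carrier (group_ring (Zmod q) G) = carrier G \<rightarrow>\<^sub>E {0..int q - 1}"
    and "f \<oplus>\<^bsub>group_ring (Zmod q) G\<^esub> g = (\<lambda>x\<in>carrier G. (f x + g x) mod int q)"
    and "\<one>\<^bsub>group_ring (Zmod q) G\<^esub> = (\<lambda>x\<in>carrier G. if x = \<one> then 1 else 0)"
    and "f \<in> carrier (group_ring (Zmod q) G) \<Longrightarrow> g \<in> carrier (group_ring (Zmod q) G) \<Longrightarrow>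
      f \<otimes>\<^bsub>group_ring (Zmod q) G\<^esub> g =
        (\<lambda>x\<in>carrier G. (\<Sum>y\<in>carrier G. f y * g (inv y \<otimes> x)) mod int q)"
proof -
  interpret group G by fact
  show car: "carrier (group_ring (Zmod q) G) = carrier G \<rightarrow>\<^sub>E {0..int q - 1}"
    using assms(2) by (simp add: group_ring_def residue_ring_def)
  show "f \<oplus>\<^bsub>group_ring (Zmod q) G\<^esub> g = (\<lambda>x\<in>carrier G. (f x + g x) mod int q)"
    by (simp add: group_ring_def residue_ring_def)
  show "\<one>\<^bsub>group_ring (Zmod q) G\<^esub> = (\<lambda>x\<in>carrier G. if x = \<one> then 1 else 0)"
    by (auto simp: group_ring_def residue_ring_def intro!: restrict_ext)
  assume f: "f \<in> carrier (group_ring (Zmod q) G)" and g: "g \<in> carrier (group_ring (Zmod q) G)"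
  have "(\<Oplus>\<^bsub>Zmod q\<^esub>y\<in>{y \<in> carrier G. f y \<noteq> 0}. f y * g (inv y \<otimes> x) mod int q) =
      (\<Sum>y\<in>carrier G. f y * g (inv y \<otimes> x)) mod int q" if "x \<in> carrier G" for x
  proof -
    have "(\<Oplus>\<^bsub>Zmod q\<^esub>y\<in>{y \<in> carrier G. f y \<noteq> 0}. f y * g (inv y \<otimes> x) mod int q) =
       (\<Sum>y\<in>{y \<in> carrier G. f y \<noteq> 0}. f y * g (inv y \<otimes> x) mod int q) mod int q"
      by (rule finsum_residue_ring) (use assms in auto)
    also have "\<dots> = (\<Sum>y\<in>{y \<in> carrier G. f y \<noteq> 0}. f y * g (inv y \<otimes> x)) mod int q"
      by (simp add: mod_sum_eq)
    also have "(\<Sum>y\<in>{y \<in> carrier G. f y \<noteq> 0}. f y * g (inv y \<otimes> x)) = (\<Sum>y\<in>carrier G. f y * g (inv y \<otimes> x))"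
      by (rule sum.mono_neutral_left) (use assms in auto)
    finally show ?thesis .
  qed
  then show "f \<otimes>\<^bsub>group_ring (Zmod q) G\<^esub> g =
        (\<lambda>x\<in>carrier G. (\<Sum>y\<in>carrier G. f y * g (inv y \<otimes> x)) mod int q)"
    by (auto simp: group_ring_def residue_ring_def intro!: restrict_ext)
qed

text \<open>The iteration ends because \<open>p ^ r\<close> annihilates \<open>B\<close>, so that a
  defect in \<open>multiples (p ^ r)\<close> is zero. It preserves the reduction \<gamma>, because
  every correction is a multiple of \<open>p\<close> and so lies in the kernel of \<pi>.\<close>

lemma multiplicative_lift:
  fixes G :: "('g, 't) monoid_scheme" (structure)
  assumes G: "group G" "finite (carrier G)" and p: "prime p" "gcd p (order G) = 1"
    and B: "p_lift (int p) r B C \<pi>"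
    and \<gamma>: "\<gamma> \<in> carrier G \<rightarrow> carrier C" "\<gamma> \<one> = \<one>\<^bsub>C\<^esub>"
      "\<And>a b. a \<in> carrier G \<Longrightarrow> b \<in> carrier G \<Longrightarrow> \<gamma> (a \<otimes> b) = \<gamma> a \<otimes>\<^bsub>C\<^esub> \<gamma> b"
  obtains \<phi> where "\<phi> \<in> carrier G \<rightarrow> carrier B" "\<phi> \<one> = \<one>\<^bsub>B\<^esub>"
    "\<And>a. a \<in> carrier G \<Longrightarrow> \<pi> (\<phi> a) = \<gamma> a"
    "\<And>a b. a \<in> carrier G \<Longrightarrow> b \<in> carrier G \<Longrightarrow> \<phi> (a \<otimes> b) = \<phi> a \<otimes>\<^bsub>B\<^esub> \<phi> b"
proof -
  note Bl = B[unfolded p_lift_def]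
  interpret G: group G by fact
  interpret B: ring B using Bl by simp
  interpret C: ring C using Bl by simp
  interpret \<pi>: ring_hom_ring B C \<pi>
    using Bl by (intro ring_hom_ringI2) (auto simp: B.ring_axioms C.ring_axioms)
  have ker: "\<pi> b = \<zero>\<^bsub>C\<^esub> \<longleftrightarrow> b \<in> B.multiples (int p)" if "b \<in> carrier B" for b
    using Bl that by (auto simp: B.multiples_def)
  have "coprime (order G) p"
    using p(2) by (simp add: coprime_iff_gcd_eq_1 gcd.commute)
  then have "coprime (int (order G)) (int p ^ r)" by simp
  then obtain N where N: "[int (order G) * N = 1] (mod (int p ^ r))"
    using cong_solve_coprime_int by blast
  \<comment> \<open>The group order is inverted only modulo \<open>p ^ r\<close>, but the
    discrepancy is a multiple of \<open>p ^ r\<close> and vanishes in \<open>B\<close>.\<close>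
  have N': "add_pow B (N * int (order G)) b = b" if b: "b \<in> carrier B" for b
  proof -
    obtain k where "N * int (order G) = 1 + k * int p ^ r"
      using N by (metis cong_iff_lin cong_sym mult.commute)
    then have "add_pow B (N * int (order G)) b = b \<oplus>\<^bsub>B\<^esub> add_pow B (int p ^ r) (add_pow B k b)"
      using b by (simp add: B.add.int_pow_mult B.add.int_pow_pow mult.commute)
    then show ?thesis using Bl b by simp
  qed
  \<comment> \<open>The exponent starts at 1: any section of \<pi> over \<gamma> has a defect that
    \<pi> sends to zero, hence a multiple of \<open>p\<close>. From exponent 0 the squaring would
    gain nothing.\<close>
  have "\<exists>\<phi>. \<phi> \<in> carrier G \<rightarrow> carrier B \<and> \<phi> \<one> = \<one>\<^bsub>B\<^esub> \<and> (\<forall>a\<in>carrier G. \<pi> (\<phi> a) = \<gamma> a) \<and>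
    (\<forall>a\<in>carrier G. \<forall>b\<in>carrier G. \<phi> a \<otimes>\<^bsub>B\<^esub> \<phi> b \<ominus>\<^bsub>B\<^esub> \<phi> (a \<otimes> b) \<in> B.multiples (int p ^ Suc s))" for s
  proof (induction s)
    case 0
    \<comment> \<open>The unit is treated separately since \<open>inv_into\<close> may choose
      another preimage of it.\<close>
    define \<phi> where "\<phi> a = (if a = \<one> then \<one>\<^bsub>B\<^esub> else inv_into (carrier B) \<pi> (\<gamma> a))" for a
    have im: "\<gamma> a \<in> \<pi> ` carrier B" if "a \<in> carrier G" for a using \<gamma> Bl that by auto
    have 1: "\<phi> a \<in> carrier B" "\<pi> (\<phi> a) = \<gamma> a" if "a \<in> carrier G" for a
      using im[OF that] \<gamma>(2) by (auto simp: \<phi>_def inv_into_into f_inv_into_f)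
    have "\<phi> a \<otimes>\<^bsub>B\<^esub> \<phi> b \<ominus>\<^bsub>B\<^esub> \<phi> (a \<otimes> b) \<in> B.multiples (int p)" if "a \<in> carrier G" "b \<in> carrier G" for a b
      using that \<gamma> funcset_mem[OF \<gamma>(1)]
      by (subst ker[symmetric]) (auto simp: 1 a_minus_def C.r_neg)
    then show ?case using 1 by (intro exI[of _ \<phi>]) (auto simp: \<phi>_def)
  next
    case (Suc s)
    then obtain \<phi> where \<phi>: "\<phi> \<in> carrier G \<rightarrow> carrier B" "\<phi> \<one> = \<one>\<^bsub>B\<^esub>" "\<And>a. a\<in>carrier G \<Longrightarrow> \<pi> (\<phi> a) = \<gamma> a"
      "\<And>a b. a\<in>carrier G \<Longrightarrow> b\<in>carrier G \<Longrightarrow> \<phi> a \<otimes>\<^bsub>B\<^esub> \<phi> b \<ominus>\<^bsub>B\<^esub> \<phi> (a \<otimes> b) \<in> B.multiples (int p ^ Suc s)"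
      by blast
    from B.improve_multiplicativity[OF G \<phi>(1,2) N' \<phi>(4)]
    obtain \<phi>' where \<phi>': "\<phi>' \<in> carrier G \<rightarrow> carrier B" "\<phi>' \<one> = \<one>\<^bsub>B\<^esub>"
      "\<And>a. a\<in>carrier G \<Longrightarrow> \<phi>' a \<ominus>\<^bsub>B\<^esub> \<phi> a \<in> B.multiples (int p ^ Suc s)"
      "\<And>a b. a\<in>carrier G \<Longrightarrow> b\<in>carrier G \<Longrightarrow>
        \<phi>' a \<otimes>\<^bsub>B\<^esub> \<phi>' b \<ominus>\<^bsub>B\<^esub> \<phi>' (a \<otimes> b) \<in> B.multiples (int p ^ Suc s * int p ^ Suc s)"
      by blast
    have "\<pi> (\<phi>' a) = \<gamma> a" if a: "a \<in> carrier G" for a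
    proof -
      have c: "\<phi> a \<in> carrier B" "\<phi>' a \<in> carrier B" using a \<phi> \<phi>' by auto
      have "\<phi>' a \<ominus>\<^bsub>B\<^esub> \<phi> a \<in> B.multiples (int p)" using \<phi>'(3)[OF a] by (rule B.multiples_dvd) simp
      then have "\<pi> (\<phi>' a) \<ominus>\<^bsub>C\<^esub> \<pi> (\<phi> a) = \<zero>\<^bsub>C\<^esub>" using c by (subst (asm) ker[symmetric]) (auto simp: a_minus_def)
      then show ?thesis using \<phi>(3)[OF a] c by (metis C.r_right_minus_eq \<pi>.hom_closed)
    qed
    \<comment> \<open>The exponent doubles, but the induction keeps only one more power;
      \<open>2 * (s + 1) \<ge> s + 2\<close> holds from \<open>s = 0\<close> on.\<close>
    moreover have "int p ^ Suc (Suc s) dvd int p ^ Suc s * int p ^ Suc s"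
      unfolding power_add[symmetric] by (rule le_imp_power_dvd) simp
    then have "\<phi>' a \<otimes>\<^bsub>B\<^esub> \<phi>' b \<ominus>\<^bsub>B\<^esub> \<phi>' (a \<otimes> b) \<in> B.multiples (int p ^ Suc (Suc s))"
      if "a \<in> carrier G" "b \<in> carrier G" for a b
      using \<phi>'(4)[OF that] B.multiples_dvd by blast
    ultimately show ?case using \<phi>' by blast
  qed
  from this[of r] obtain \<phi> where \<phi>: "\<phi> \<in> carrier G \<rightarrow> carrier B" "\<phi> \<one> = \<one>\<^bsub>B\<^esub>" "\<And>a. a\<in>carrier G \<Longrightarrow> \<pi> (\<phi> a) = \<gamma> a"
    "\<And>a b. a\<in>carrier G \<Longrightarrow> b\<in>carrier G \<Longrightarrow> \<phi> a \<otimes>\<^bsub>B\<^esub> \<phi> b \<ominus>\<^bsub>B\<^esub> \<phi> (a \<otimes> b) \<in> B.multiples (int p ^ Suc r)"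
    by blast
  have "\<phi> (a \<otimes> b) = \<phi> a \<otimes>\<^bsub>B\<^esub> \<phi> b" if a: "a \<in> carrier G" and b: "b \<in> carrier G" for a b
  proof -
    have c: "\<phi> a \<in> carrier B" "\<phi> b \<in> carrier B" "\<phi> (a \<otimes> b) \<in> carrier B" using \<phi>(1) a b by auto
    have "\<phi> a \<otimes>\<^bsub>B\<^esub> \<phi> b \<ominus>\<^bsub>B\<^esub> \<phi> (a \<otimes> b) \<in> B.multiples (int p ^ r)"
      using \<phi>(4)[OF a b] by (rule B.multiples_dvd) (simp add: le_imp_power_dvd)
    then have "\<phi> a \<otimes>\<^bsub>B\<^esub> \<phi> b \<ominus>\<^bsub>B\<^esub> \<phi> (a \<otimes> b) = \<zero>\<^bsub>B\<^esub>"
      using Bl by (auto simp: B.multiples_def)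
    then show ?thesis using c by (metis B.m_closed B.r_right_minus_eq)
  qed
  then show ?thesis using \<phi> that by blast
qed

text \<open>Stated for an arbitrary lift \<open>B\<close>, since the matrix structure enters only
  through \<open>p_lift\<close>. Surjectivity of the extended map rests on the kernel clause,
  injectivity on the last clause.\<close>

lemma group_ring_lift_iso:
  fixes G :: "('g, 't) monoid_scheme" (structure)
  assumes G: "group G" "finite (carrier G)" and p: "prime p" "gcd p (order G) = 1" and r: "1 \<le> r"
    and B: "p_lift (int p) r B C \<pi>"
    and \<psi>: "\<psi> \<in> ring_iso (group_ring (Zmod p) G) C"
  shows "group_ring (Zmod (p ^ r)) G \<simeq> B"
proof -
  note Bl = B[unfolded p_lift_def]
  let ?F = "group_ring (Zmod p) G" and ?A = "group_ring (Zmod (p ^ r)) G"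
  interpret G: group G by fact
  interpret B: ring B using Bl by simp
  interpret C: ring C using Bl by simp
  interpret \<pi>: ring_hom_ring B C \<pi>
    using Bl by (intro ring_hom_ringI2) (auto simp: B.ring_axioms C.ring_axioms)
  have p1: "p > 1" using p prime_gt_1_nat by simp
  have q1: "p ^ r > 1" using p1 r by (intro one_less_power) auto
  have q0: "int (p ^ r) > 0" using q1 by linarith
  note F = group_ring_Zmod_simps[OF G p1] and A = group_ring_Zmod_simps[OF G q1]
  have ker: "\<pi> b = \<zero>\<^bsub>C\<^esub> \<longleftrightarrow> (\<exists>b'\<in>carrier B. b = add_pow B (int p) b')" if "b \<in> carrier B" for b
    using Bl that by auto
  have pC: "add_pow C (int p) c = \<zero>\<^bsub>C\<^esub>" if "c \<in> carrier C" for c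
  proof -
    have "c \<in> \<pi> ` carrier B" using Bl that by simp
    then obtain b where b: "b \<in> carrier B" "c = \<pi> b" by blast
    then have "add_pow C (int p) c = \<pi> (add_pow B (int p) b)"
      by (subst add_pow_hom[OF B.abelian_group_axioms C.abelian_group_axioms, of \<pi>]) auto
    then show ?thesis using b ker by auto
  qed
  \<comment> \<open>Coefficients in the group ring are stored as remainders, so integer multiples in
    \<open>C\<close>, and below in \<open>B\<close>, must not change when a coefficient is
    reduced.\<close>
  have modC: "add_pow C (k mod int p) c = add_pow C k c" if "c \<in> carrier C" for c k
  proof -
    have "add_pow C k c = add_pow C (k mod int p + int p * (k div int p)) c" by simp
    also have "\<dots> = add_pow C (k mod int p) c"
      using that by (simp only: C.add.int_pow_mult) (simp add: C.add.int_pow_pow[symmetric] mult.commute pC)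
    finally show ?thesis by simp
  qed
  have modB: "add_pow B (k mod int (p ^ r)) b = add_pow B k b" if "b \<in> carrier B" for b k
  proof -
    have "add_pow B k b = add_pow B (k mod int (p ^ r) + int (p ^ r) * (k div int (p ^ r))) b" by simp
    also have "\<dots> = add_pow B (k mod int (p ^ r)) b"
      using that Bl by (simp only: B.add.int_pow_mult) (simp add: B.add.int_pow_pow[symmetric] mult.commute)
    finally show ?thesis by simp
  qed
  have \<psi>h: "\<psi> \<in> Ring.ring_hom ?F C" and \<psi>b: "bij_betw \<psi> (carrier ?F) (carrier C)"
    using \<psi> by (auto simp: ring_iso_def)
  note \<psi>_closed = ring_hom_closed[OF \<psi>h] and \<psi>_add = ring_hom_add[OF \<psi>h]
  define single where "single k g = (\<lambda>x\<in>carrier G. if x = g then k mod int p else 0)" for k g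
  have single [simp, intro]: "single k g \<in> carrier ?F" for k g
    using p1 by (auto simp: F single_def)
  have zero: "(\<lambda>x\<in>carrier G. 0) \<in> carrier ?F" using p1 by (auto simp: F)
  have \<psi>0: "\<psi> (\<lambda>x\<in>carrier G. 0) = \<zero>\<^bsub>C\<^esub>"
  proof -
    have "(\<lambda>x\<in>carrier G. 0) \<oplus>\<^bsub>?F\<^esub> (\<lambda>x\<in>carrier G. 0) = (\<lambda>x\<in>carrier G. 0)" by (auto simp: F)
    then show ?thesis using \<psi>_add[OF zero zero] \<psi>_closed[OF zero] C.add.l_cancel_one by simp
  qed
  define \<gamma> where "\<gamma> g = \<psi> (single 1 g)" for g
  have \<gamma>_closed [simp, intro]: "\<gamma> g \<in> carrier C" for g by (simp add: \<gamma>_def \<psi>_closed)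
  have \<gamma>1: "\<gamma> \<one> = \<one>\<^bsub>C\<^esub>"
  proof -
    have "single 1 \<one> = \<one>\<^bsub>?F\<^esub>" using p1 by (auto simp: F single_def intro!: restrict_ext)
    then show ?thesis using ring_hom_one[OF \<psi>h] by (simp add: \<gamma>_def)
  qed
  have \<gamma>_mult: "\<gamma> (a \<otimes> b) = \<gamma> a \<otimes>\<^bsub>C\<^esub> \<gamma> b" if a: "a \<in> carrier G" and b: "b \<in> carrier G" for a b
  proof -
    have "(\<Sum>y\<in>carrier G. single 1 a y * single 1 b (inv y \<otimes> x)) mod int p = single 1 (a \<otimes> b) x"
      if x: "x \<in> carrier G" for x
    proof -
      have "(\<Sum>y\<in>carrier G. single 1 a y * single 1 b (inv y \<otimes> x)) =
        (\<Sum>y\<in>carrier G. if y = a then single 1 b (inv a \<otimes> x) else 0)"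
        using p1 by (intro sum.cong) (auto simp: single_def)
      also have "\<dots> = single 1 b (inv a \<otimes> x)" using a G by simp
      also have "\<dots> = single 1 (a \<otimes> b) x"
        using a b x by (auto simp: single_def G.inv_solve_left' G.inv_solve_left)
      finally show ?thesis using p1 x by (simp add: single_def)
    qed
    then have "single 1 (a \<otimes> b) = single 1 a \<otimes>\<^bsub>?F\<^esub> single 1 b"
      unfolding F(4)[OF single single] by (intro ext) (simp add: single_def)
    then show ?thesis by (simp add: \<gamma>_def ring_hom_mult[OF \<psi>h])
  qed
  \<comment> \<open>\<psi> is only known to be additive, so multiples are reached by induction on a
    natural number; an arbitrary integer is then handled through its remainder modulo
    \<open>p\<close>.\<close>
  have \<psi>_single: "\<psi> (single k g) = add_pow C k (\<gamma> g)" for k g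
  proof -
    have "\<psi> (single (int n) g) = add_pow C (int n) (\<gamma> g)" for n
    proof (induction n)
      case 0
      have "single 0 g = (\<lambda>x\<in>carrier G. 0)" by (auto simp: single_def)
      then show ?case by (simp only: of_nat_0 \<psi>0 add_pow_int_0)
    next
      case (Suc n)
      have "single (int (Suc n)) g = single (int n) g \<oplus>\<^bsub>?F\<^esub> single 1 g"
        by (auto simp: F single_def mod_simps add.commute intro!: restrict_ext)
      then have "\<psi> (single (int (Suc n)) g) = \<psi> (single (int n) g) \<oplus>\<^bsub>C\<^esub> \<gamma> g"
        by (simp add: \<psi>_add \<gamma>_def)
      also have "\<dots> = add_pow C (int n + 1) (\<gamma> g)"
        by (simp add: Suc C.add.int_pow_mult)
      finally show ?case by (simp add: add.commute)
    qed
    from this[of "nat (k mod int p)"] have "\<psi> (single (k mod int p) g) = add_pow C (k mod int p) (\<gamma> g)"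
      using p1 by simp
    moreover have "single (k mod int p) g = single k g" by (auto simp: single_def)
    ultimately show ?thesis by (simp add: modC)
  qed
  obtain \<phi> where \<phi>: "\<phi> \<in> carrier G \<rightarrow> carrier B" "\<phi> \<one> = \<one>\<^bsub>B\<^esub>"
    "\<And>a. a \<in> carrier G \<Longrightarrow> \<pi> (\<phi> a) = \<gamma> a"
    "\<And>a b. a \<in> carrier G \<Longrightarrow> b \<in> carrier G \<Longrightarrow> \<phi> (a \<otimes> b) = \<phi> a \<otimes>\<^bsub>B\<^esub> \<phi> b"
    using multiplicative_lift[OF G p B, of \<gamma>] \<gamma>1 \<gamma>_mult by blast
  have \<phi>c [simp, intro]: "\<phi> g \<in> carrier B" if "g \<in> carrier G" for g using \<phi>(1) that by auto
  \<comment> \<open>Defined on all integer valued functions, not only on reduced ones. Additivity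
    and scaling then hold without remainders, and coefficients can be subtracted or divided by
    powers of \<open>p\<close> without leaving the domain.\<close>
  define \<Phi> where "\<Phi> f = (\<Oplus>\<^bsub>B\<^esub>g\<in>carrier G. add_pow B (f g :: int) (\<phi> g))" for f
  have \<Phi>c [simp, intro]: "\<Phi> f \<in> carrier B" for f by (auto simp: \<Phi>_def intro!: B.finsum_closed)
  have \<Phi>_cong: "\<Phi> f = \<Phi> f'" if "\<And>x. x \<in> carrier G \<Longrightarrow> f x mod int (p ^ r) = f' x mod int (p ^ r)" for f f'
    unfolding \<Phi>_def
  proof (rule B.finsum_cong')
    fix g assume g: "g \<in> carrier G"
    show "add_pow B (f g) (\<phi> g) = add_pow B (f' g) (\<phi> g)"
      using modB[of "\<phi> g" "f g"] modB[of "\<phi> g" "f' g"] that[OF g] g by simp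
  qed auto
  have \<Phi>_add: "\<Phi> (\<lambda>x. f x + f' x) = \<Phi> f \<oplus>\<^bsub>B\<^esub> \<Phi> f'" for f f'
  proof -
    have "\<Phi> (\<lambda>x. f x + f' x) =
      (\<Oplus>\<^bsub>B\<^esub>g\<in>carrier G. add_pow B (f g) (\<phi> g) \<oplus>\<^bsub>B\<^esub> add_pow B (f' g) (\<phi> g))"
      unfolding \<Phi>_def by (rule B.finsum_cong') (auto simp: B.add.int_pow_mult)
    then show ?thesis by (simp add: \<Phi>_def B.finsum_addf Pi_def)
  qed
  have \<Phi>_scale: "\<Phi> (\<lambda>x. k * f x) = add_pow B k (\<Phi> f)" for k f
  proof -
    have "add_pow B k (\<Phi> f) = (\<Oplus>\<^bsub>B\<^esub>g\<in>carrier G. add_pow B k (add_pow B (f g) (\<phi> g)))"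
      unfolding \<Phi>_def by (rule finsum_hom[OF B.abelian_group_axioms B.abelian_group_axioms])
        (auto simp: B.add.int_pow_distrib)
    also have "\<dots> = \<Phi> (\<lambda>x. k * f x)"
      unfolding \<Phi>_def by (rule B.finsum_cong') (auto simp: B.add.int_pow_pow mult.commute)
    finally show ?thesis by simp
  qed
  have \<pi>\<Phi>: "\<pi> (\<Phi> f) = \<psi> (\<lambda>x\<in>carrier G. f x mod int p)" for f
  proof -
    \<comment> \<open>Induction on the set of coefficients already included, the others being zero,
      so that each step adds one \<open>single\<close>.\<close>
    have "\<psi> (\<lambda>x\<in>carrier G. if x \<in> S then f x mod int p else 0) = (\<Oplus>\<^bsub>C\<^esub>g\<in>S. add_pow C (f g) (\<gamma> g))"
      if "finite S" "S \<subseteq> carrier G" for S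
      using that
    proof (induction S rule: finite_induct)
      case empty
      show ?case by (simp only: \<psi>0 empty_iff if_False C.finsum_empty)
    next
      case (insert g S)
      let ?f = "\<lambda>S. \<lambda>x\<in>carrier G. if x \<in> S then f x mod int p else 0"
      have "?f S \<in> carrier ?F" using p1 by (auto simp: F)
      moreover have "?f (insert g S) = single (f g) g \<oplus>\<^bsub>?F\<^esub> ?f S"
        using insert by (auto simp: F single_def mod_simps intro!: restrict_ext)
      ultimately have "\<psi> (?f (insert g S)) = \<psi> (single (f g) g) \<oplus>\<^bsub>C\<^esub> \<psi> (?f S)"
        using \<psi>_add by simp
      also have "\<dots> = (\<Oplus>\<^bsub>C\<^esub>g\<in>insert g S. add_pow C (f g) (\<gamma> g))"
        using insert by (subst insert.IH) (simp_all add: \<psi>_single Pi_def)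
      finally show ?case .
    qed
    from this[OF G(2) order.refl]
    have "\<psi> (\<lambda>x\<in>carrier G. if x \<in> carrier G then f x mod int p else 0) =
      (\<Oplus>\<^bsub>C\<^esub>g\<in>carrier G. add_pow C (f g) (\<gamma> g))" .
    also have "(\<lambda>x\<in>carrier G. if x \<in> carrier G then f x mod int p else 0) = (\<lambda>x\<in>carrier G. f x mod int p)"
      by (auto intro!: restrict_ext)
    also have "(\<Oplus>\<^bsub>C\<^esub>g\<in>carrier G. add_pow C (f g) (\<gamma> g)) =
        (\<Oplus>\<^bsub>C\<^esub>g\<in>carrier G. \<pi> (add_pow B (f g) (\<phi> g)))"
      by (rule C.finsum_cong')
        (auto simp: \<phi>(3) add_pow_hom[OF B.abelian_group_axioms C.abelian_group_axioms, of \<pi>])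
    also have "\<dots> = \<pi> (\<Phi> f)" by (simp add: \<Phi>_def Pi_def comp_def)
    finally show ?thesis by (simp only:)
  qed
  \<comment> \<open>Successive approximation: the error is \<open>p ^ s\<close> times some
    \<open>b'\<close>, and approximating \<open>b'\<close> modulo \<open>p\<close> gains one more
    factor. At \<open>s = r\<close> the error vanishes.\<close>
  have surj: "\<exists>f. \<exists>b'\<in>carrier B. b = \<Phi> f \<oplus>\<^bsub>B\<^esub> add_pow B (int p ^ s) b'" if b: "b \<in> carrier B" for b s
  proof (induction s)
    case 0
    have "\<Phi> (\<lambda>x. 0) = \<zero>\<^bsub>B\<^esub>" using \<Phi>_scale[of 0 "\<lambda>x. 0"] by simp
    then show ?case using b by (intro exI[of _ "\<lambda>x. 0"] bexI[of _ b]) auto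
  next
    case (Suc s)
    then obtain f b' where b': "b' \<in> carrier B" "b = \<Phi> f \<oplus>\<^bsub>B\<^esub> add_pow B (int p ^ s) b'" by blast
    have "\<pi> b' \<in> \<psi> ` carrier ?F" using b' \<psi>b by (simp add: bij_betw_def)
    then obtain f' where f': "f' \<in> carrier ?F" "\<pi> b' = \<psi> f'" by blast
    have "(\<lambda>x\<in>carrier G. f' x mod int p) = f'" using f'(1) by (intro ext) (auto simp: F PiE_iff extensional_def)
    then have "\<pi> (\<Phi> f') = \<pi> b'" using f' \<pi>\<Phi> by simp
    then have "\<pi> (b' \<ominus>\<^bsub>B\<^esub> \<Phi> f') = \<zero>\<^bsub>C\<^esub>" using b' by (simp add: a_minus_def C.r_neg)
    then obtain b'' where b'': "b'' \<in> carrier B" "b' \<ominus>\<^bsub>B\<^esub> \<Phi> f' = add_pow B (int p) b''"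
      using b' ker by auto
    have "b' = \<Phi> f' \<oplus>\<^bsub>B\<^esub> add_pow B (int p) b''"
      unfolding b''(2)[symmetric] using b'(1) by (simp add: a_minus_def B.a_lcomm B.r_neg)
    then have "b = \<Phi> f \<oplus>\<^bsub>B\<^esub> (add_pow B (int p ^ s) (\<Phi> f') \<oplus>\<^bsub>B\<^esub> add_pow B (int p ^ s) (add_pow B (int p) b''))"
      using b' b''(1) by (simp add: B.add.int_pow_distrib)
    also have "\<dots> = \<Phi> (\<lambda>x. f x + int p ^ s * f' x) \<oplus>\<^bsub>B\<^esub> add_pow B (int p ^ Suc s) b''"
      using b''(1) by (simp add: \<Phi>_add \<Phi>_scale B.a_assoc B.add.int_pow_pow)
    finally show ?case using b''(1) by blast
  qed
  have inj: "\<forall>x\<in>carrier G. int (p ^ r) dvd f x" if 0: "\<Phi> f = \<zero>\<^bsub>B\<^esub>" for f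
  proof -
    \<comment> \<open>Divisibility is raised one power at a time. The quotient of \<open>f\<close>
      by \<open>p ^ s\<close> has an image annihilated by \<open>p ^ s\<close>, hence by
      \<open>p ^ (r - 1)\<close> as long as \<open>s < r\<close>; the last clause of
      \<open>p_lift\<close> then applies, and injectivity of \<psi> yields the next factor
      \<open>p\<close>.\<close>
    have "s \<le> r \<Longrightarrow> \<forall>x\<in>carrier G. int p ^ s dvd f x" for s
    proof (induction s)
      case (Suc s)
      let ?f = "\<lambda>x. f x div int p ^ s"
      have "\<Phi> f = \<Phi> (\<lambda>x. int p ^ s * ?f x)" using Suc by (intro \<Phi>_cong) auto
      then have "add_pow B (int p ^ s) (\<Phi> ?f) = \<zero>\<^bsub>B\<^esub>" by (simp add: \<Phi>_scale 0)
      then have "add_pow B (int p ^ (r - 1 - s)) (add_pow B (int p ^ s) (\<Phi> ?f)) = \<zero>\<^bsub>B\<^esub>" by simp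
      then have "add_pow B (int p ^ (r - 1)) (\<Phi> ?f) = \<zero>\<^bsub>B\<^esub>"
        using Suc(2) by (simp add: B.add.int_pow_pow power_add[symmetric])
      then have "\<pi> (\<Phi> ?f) = \<zero>\<^bsub>C\<^esub>" using Bl by auto
      then have "\<psi> (\<lambda>x\<in>carrier G. ?f x mod int p) = \<psi> (\<lambda>x\<in>carrier G. 0)" by (simp add: \<pi>\<Phi> \<psi>0)
      moreover have "(\<lambda>x\<in>carrier G. ?f x mod int p) \<in> carrier ?F" using p1 by (auto simp: F)
      ultimately have "(\<lambda>x\<in>carrier G. ?f x mod int p) = (\<lambda>x\<in>carrier G. 0)"
        using \<psi>b zero by (auto simp: bij_betw_def inj_on_def)
      then have "?f x mod int p = 0" if "x \<in> carrier G" for x using that by (metis restrict_apply')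
      then have "int p ^ s * int p dvd int p ^ s * ?f x" if "x \<in> carrier G" for x
        using that by (intro mult_dvd_mono) (auto simp: dvd_eq_mod_eq_0)
      then show ?case using Suc by (simp add: mult.commute)
    qed simp
    then show ?thesis by simp
  qed
  have "\<Phi> \<in> ring_iso ?A B"
    unfolding ring_iso_def
  proof (intro CollectI conjI)
    show "\<Phi> \<in> Ring.ring_hom ?A B"
    proof (rule ring_hom_memI)
      fix f f' assume f: "f \<in> carrier ?A" and f': "f' \<in> carrier ?A"
      have "\<Phi> (f \<otimes>\<^bsub>?A\<^esub> f') = \<Phi> (\<lambda>x. \<Sum>y\<in>carrier G. f y * f' (inv y \<otimes> x))"
        by (rule \<Phi>_cong) (simp add: A(4)[OF f f'] del: of_nat_power)
      also have "\<dots> = (\<Oplus>\<^bsub>B\<^esub>x\<in>carrier G. \<Oplus>\<^bsub>B\<^esub>y\<in>carrier G. add_pow B (f y * f' (inv y \<otimes> x)) (\<phi> x))"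
        unfolding \<Phi>_def
      proof (rule B.finsum_cong')
        fix x assume x: "x \<in> carrier G"
        have "add_pow B (\<Sum>y\<in>S. f y * f' (inv y \<otimes> x)) (\<phi> x) =
          (\<Oplus>\<^bsub>B\<^esub>y\<in>S. add_pow B (f y * f' (inv y \<otimes> x)) (\<phi> x))" if "finite S" for S
          using that by induction (use x in \<open>auto simp: B.add.int_pow_mult\<close>)
        from this[OF G(2)] show "add_pow B (\<Sum>y\<in>carrier G. f y * f' (inv y \<otimes> x)) (\<phi> x) =
          (\<Oplus>\<^bsub>B\<^esub>y\<in>carrier G. add_pow B (f y * f' (inv y \<otimes> x)) (\<phi> x))" .
      qed (auto intro!: B.finsum_closed)
      also have "\<dots> = (\<Oplus>\<^bsub>B\<^esub>y\<in>carrier G. \<Oplus>\<^bsub>B\<^esub>x\<in>carrier G. add_pow B (f y * f' (inv y \<otimes> x)) (\<phi> x))"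
        by (rule B.finsum_swap) (use G in auto)
      also have "\<dots> = (\<Oplus>\<^bsub>B\<^esub>y\<in>carrier G. add_pow B (f y) (\<phi> y) \<otimes>\<^bsub>B\<^esub> \<Phi> f')"
      proof (rule B.finsum_cong')
        fix y assume y: "y \<in> carrier G"
        \<comment> \<open>Left translation by \<open>y\<close> substitutes \<open>y z\<close> for
          \<open>x\<close>, after which multiplicativity of \<phi> splits each term into its two
          factors.\<close>
        have bij: "(\<lambda>h. y \<otimes> h) ` carrier G = carrier G" "inj_on (\<lambda>h. y \<otimes> h) (carrier G)"
          using y by (auto simp: G.surj_const_mult G.inj_on_cmult)
        have "(\<Oplus>\<^bsub>B\<^esub>x\<in>(\<lambda>h. y \<otimes> h) ` carrier G. add_pow B (f y * f' (inv y \<otimes> x)) (\<phi> x)) =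
          (\<Oplus>\<^bsub>B\<^esub>z\<in>carrier G. add_pow B (f y * f' (inv y \<otimes> (y \<otimes> z))) (\<phi> (y \<otimes> z)))"
          by (rule B.add.finprod_reindex) (use y bij in auto)
        also have "\<dots> = (\<Oplus>\<^bsub>B\<^esub>z\<in>carrier G. add_pow B (f y) (\<phi> y) \<otimes>\<^bsub>B\<^esub> add_pow B (f' z) (\<phi> z))"
        proof (rule B.finsum_cong')
          fix z assume z: "z \<in> carrier G"
          have "inv y \<otimes> (y \<otimes> z) = z" using y z by (simp add: G.m_assoc[symmetric])
          then show "add_pow B (f y * f' (inv y \<otimes> (y \<otimes> z))) (\<phi> (y \<otimes> z)) =
            add_pow B (f y) (\<phi> y) \<otimes>\<^bsub>B\<^esub> add_pow B (f' z) (\<phi> z)"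
            using y z by (simp add: \<phi>(4) B.add_pow_ldistr_int B.add_pow_rdistr_int B.add.int_pow_pow mult.commute)
        qed (use y in auto)
        also have "\<dots> = add_pow B (f y) (\<phi> y) \<otimes>\<^bsub>B\<^esub> \<Phi> f'"
          using y G by (simp add: \<Phi>_def B.finsum_rdistr Pi_def)
        finally show "(\<Oplus>\<^bsub>B\<^esub>x\<in>carrier G. add_pow B (f y * f' (inv y \<otimes> x)) (\<phi> x)) =
          add_pow B (f y) (\<phi> y) \<otimes>\<^bsub>B\<^esub> \<Phi> f'" by (simp add: bij)
      qed auto
      also have "\<dots> = \<Phi> f \<otimes>\<^bsub>B\<^esub> \<Phi> f'"
        using G unfolding \<Phi>_def[of f] by (subst B.finsum_ldistr) (auto simp: Pi_def)
      finally show "\<Phi> (f \<otimes>\<^bsub>?A\<^esub> f') = \<Phi> f \<otimes>\<^bsub>B\<^esub> \<Phi> f'" .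
      have "\<Phi> (f \<oplus>\<^bsub>?A\<^esub> f') = \<Phi> (\<lambda>x. f x + f' x)" by (rule \<Phi>_cong) (simp add: A del: of_nat_power)
      then show "\<Phi> (f \<oplus>\<^bsub>?A\<^esub> f') = \<Phi> f \<oplus>\<^bsub>B\<^esub> \<Phi> f'" by (simp add: \<Phi>_add)
    next
      have "\<Phi> \<one>\<^bsub>?A\<^esub> = (\<Oplus>\<^bsub>B\<^esub>g\<in>carrier G. if g = \<one> then \<phi> g else \<zero>\<^bsub>B\<^esub>)"
        unfolding \<Phi>_def A by (rule B.finsum_cong') auto
      also have "\<dots> = \<phi> \<one>" by (rule B.finsum_delta) (use G in auto)
      finally show "\<Phi> \<one>\<^bsub>?A\<^esub> = \<one>\<^bsub>B\<^esub>" by (simp add: \<phi>(2))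
    qed simp
    show "bij_betw \<Phi> (carrier ?A) (carrier B)"
      unfolding bij_betw_def
    proof
      show "inj_on \<Phi> (carrier ?A)"
      proof (rule inj_onI)
        fix f f' assume f: "f \<in> carrier ?A" and f': "f' \<in> carrier ?A" and eq: "\<Phi> f = \<Phi> f'"
        have "\<Phi> f' \<oplus>\<^bsub>B\<^esub> \<Phi> (\<lambda>x. f x - f' x) = \<Phi> f'"
          unfolding \<Phi>_add[symmetric] by (simp add: eq)
        then have "\<Phi> (\<lambda>x. f x - f' x) = \<zero>\<^bsub>B\<^esub>" using B.add.l_cancel_one by simp
        then have d: "int (p ^ r) dvd f x - f' x" if "x \<in> carrier G" for x using inj that by blast
        show "f = f'"
        proof (rule PiE_ext)
          show "f \<in> carrier G \<rightarrow>\<^sub>E {0..int (p ^ r) - 1}" "f' \<in> carrier G \<rightarrow>\<^sub>E {0..int (p ^ r) - 1}"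
            using f f' by (simp_all only: A)
          fix x assume x: "x \<in> carrier G"
          have "f x \<in> {0..int (p ^ r) - 1}" "f' x \<in> {0..int (p ^ r) - 1}"
            using PiE_mem[OF f[unfolded A(1)] x] PiE_mem[OF f'[unfolded A(1)] x] by simp_all
          then show "f x = f' x" using d[OF x] mod_eq_dvd_iff[of "f x" "int (p ^ r)" "f' x"] by auto
        qed
      qed
      show "\<Phi> ` carrier ?A = carrier B"
      proof
        show "carrier B \<subseteq> \<Phi> ` carrier ?A"
        proof
          fix b assume b: "b \<in> carrier B"
          obtain f b' where "b' \<in> carrier B" "b = \<Phi> f \<oplus>\<^bsub>B\<^esub> add_pow B (int p ^ r) b'"
            using surj[OF b] by blast
          then have "b = \<Phi> f" using Bl by simp
          also have "\<dots> = \<Phi> (\<lambda>x\<in>carrier G. f x mod int (p ^ r))" by (rule \<Phi>_cong) simp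
          also have "\<dots> \<in> \<Phi> ` carrier ?A"
            by (rule imageI) (use q1 in \<open>auto simp: A pos_mod_sign[OF q0] pos_mod_bound[OF q0] simp del: of_nat_power\<close>)
          finally show "b \<in> \<Phi> ` carrier ?A" .
        qed
      qed auto
    qed
  qed
  then show ?thesis by (auto simp: is_ring_iso_def)
qed

section \<open>Galois rings\<close>

text \<open>A polynomial is its own coefficient function. As a simp rule this allows pointwise
  computation; it is switched off where rules stated with \<open>coeff\<close> have to
  match.\<close>

lemma up_coeff [simp]: "f \<in> carrier (UP R) \<Longrightarrow> up_ring.coeff (UP R) f = f"
  by (auto simp: UP_def)

lemma UP_ops:
  assumes "f \<in> carrier (UP R)" "g \<in> carrier (UP R)"
  shows "(f \<oplus>\<^bsub>UP R\<^esub> g) i = f i \<oplus>\<^bsub>R\<^esub> g i"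
    and "(f \<otimes>\<^bsub>UP R\<^esub> g) i = (\<Oplus>\<^bsub>R\<^esub>j\<in>{..i}. f j \<otimes>\<^bsub>R\<^esub> g (i - j))"
  using assms by (auto simp: UP_def)

lemma UP_0_1:
  "\<zero>\<^bsub>UP R\<^esub> i = \<zero>\<^bsub>R\<^esub>" "\<one>\<^bsub>UP R\<^esub> i = (if i = 0 then \<one>\<^bsub>R\<^esub> else \<zero>\<^bsub>R\<^esub>)"
  by (auto simp: UP_def)

lemma UP_closed: "f \<in> carrier (UP R) \<Longrightarrow> f i \<in> carrier R"
  by (auto simp: UP_def)

text \<open>The base ring may have zero divisors, but with leading coefficient 1 in \<open>g\<close>
  the top coefficient of the product is that of \<open>t\<close>. This is what makes remainders
  modulo a monic polynomial unique.\<close>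

lemma (in UP_ring) monic_mult_deg:
  assumes g: "monic_UP R g" and t: "t \<in> carrier P" "t \<noteq> \<zero>\<^bsub>P\<^esub>"
  shows "g \<otimes>\<^bsub>P\<^esub> t \<noteq> \<zero>\<^bsub>P\<^esub>" "deg R (g \<otimes>\<^bsub>P\<^esub> t) = deg R g + deg R t"
proof -
  have g': "g \<in> carrier P" "coeff P g (deg R g) = \<one>" using g by (auto simp: monic_UP_def P_def)
  have lc: "coeff P t (deg R t) \<noteq> \<zero>" using t lcoeff_nonzero by blast
  have "coeff P (g \<otimes>\<^bsub>P\<^esub> t) (deg R g + deg R t) = coeff P g (deg R g) \<otimes> coeff P t (deg R t)"
  proof -
    have "coeff P (g \<otimes>\<^bsub>P\<^esub> t) (deg R g + deg R t) =
      (\<Oplus>i\<in>{..deg R g + deg R t}. if i = deg R g then coeff P g i \<otimes> coeff P t (deg R g + deg R t - i) else \<zero>)"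
      using g' t
    proof (subst coeff_mult, simp, simp, intro R.finsum_cong')
      fix i :: nat assume "i \<in> {..deg R g + deg R t}"
      show "coeff P g i \<otimes> coeff P t (deg R g + deg R t - i) =
        (if i = deg R g then coeff P g i \<otimes> coeff P t (deg R g + deg R t - i) else \<zero>)"
        using g' t deg_aboveD[of g i] deg_aboveD[of t "deg R g + deg R t - i"]
        by (cases i "deg R g" rule: linorder_cases) auto
    qed auto
    also have "\<dots> = coeff P g (deg R g) \<otimes> coeff P t (deg R g + deg R t - deg R g)"
      by (rule R.finsum_delta) (use g' t in auto)
    finally show ?thesis by simp
  qed
  then have c: "coeff P (g \<otimes>\<^bsub>P\<^esub> t) (deg R g + deg R t) \<noteq> \<zero>" using g' lc t by simp
  then show "g \<otimes>\<^bsub>P\<^esub> t \<noteq> \<zero>\<^bsub>P\<^esub>" by auto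
  show "deg R (g \<otimes>\<^bsub>P\<^esub> t) = deg R g + deg R t"
    using g' t c by (intro le_antisym deg_mult_ring deg_belowI) auto
qed

text \<open>\<open>long_div_theorem\<close> divides only after scaling by a power of the leading
  coefficient, which is 1 here. Positive degree of \<open>g\<close> lets the zero remainder, whose
  degree counts as 0, satisfy the same bound as the others.\<close>

lemma (in UP_cring) monic_division:
  assumes g: "monic_UP R g" and f: "f \<in> carrier P" and m: "0 < deg R g"
  obtains a b where "a \<in> carrier P" "b \<in> carrier P" "f = g \<otimes>\<^bsub>P\<^esub> a \<oplus>\<^bsub>P\<^esub> b" "deg R b < deg R g"
proof -
  have g': "g \<in> carrier P" "coeff P g (deg R g) = \<one>" using g by (auto simp: monic_UP_def P_def)
  have "g \<noteq> \<zero>\<^bsub>P\<^esub>" using m by auto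
  from long_div_theorem[OF g'(1) f this] obtain q r k where
    "q \<in> carrier P" "r \<in> carrier P" "(coeff P g (deg R g)) [^] (k::nat) \<odot>\<^bsub>P\<^esub> f = g \<otimes>\<^bsub>P\<^esub> q \<oplus>\<^bsub>P\<^esub> r"
    "r = \<zero>\<^bsub>P\<^esub> \<or> deg R r < deg R g" by blast
  then show ?thesis using that[of q r] g' f m by auto
qed

section \<open>Polynomials over residue rings and their reduction modulo p\<close>

lemma (in residues) add_pow_res:
  assumes "a \<in> carrier R"
  shows "add_pow R (k::int) a = (k * a) mod m"
proof -
  have nat: "add_pow R (int n) a = (int n * a) mod m" for n
  proof (induction n)
    case (Suc n)
    have "add_pow R (int n + 1) a = add_pow R (int n) a \<oplus> a"
      using assms by (simp add: add.int_pow_mult)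
    then show ?case using Suc assms by (simp add: res_add_eq algebra_simps mod_simps)
  qed (simp add: res_zero_eq add_pow_def)
  show ?thesis
  proof (cases "k \<ge> 0")
    case True then show ?thesis using nat[of "nat k"] by simp
  next
    case False
    have "add_pow R k a = \<ominus> add_pow R (int (nat (- k))) a"
      using False assms add.int_pow_neg[of a "- k"] by simp
    then show ?thesis using False nat[of "nat (- k)"] by (simp add: res_neg_eq mod_simps)
  qed
qed

lemma Zmod_UP_cring:
  assumes "q > 1"
  shows "UP_cring (Zmod q)"
proof -
  interpret residues "int q" "Zmod q" using assms by unfold_locales auto
  show ?thesis by unfold_locales
qed

lemma add_pow_UP_Zmod:
  assumes q: "q > 1" and f: "f \<in> carrier (UP (Zmod q))"
  shows "add_pow (UP (Zmod q)) (k::int) f j = (k * f j) mod int q"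
proof -
  interpret residues "int q" "Zmod q" using q by unfold_locales auto
  interpret U: UP_cring "Zmod q" "UP (Zmod q)" using Zmod_UP_cring[OF q] by simp
  have "add_pow (UP (Zmod q)) k f j = add_pow (Zmod q) k (f j)"
    by (rule add_pow_hom[where f = "\<lambda>f. f j"])
      (use f U.P.abelian_group_axioms abelian_group_axioms in \<open>auto simp: UP_ops UP_closed\<close>)
  then show ?thesis using add_pow_res UP_closed[OF f] by simp
qed

definition reduce_UP :: "nat \<Rightarrow> (nat \<Rightarrow> int) \<Rightarrow> nat \<Rightarrow> int" where
  "reduce_UP p f = (\<lambda>j. f j mod int p)"

lemma in_UP_Zmod:
  assumes "q > 1"
  shows "f \<in> carrier (UP (Zmod q)) \<longleftrightarrow> (\<forall>j. 0 \<le> f j \<and> f j < int q) \<and> (\<exists>n. \<forall>j>n. f j = 0)"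
  by (auto simp: UP_def up_def bound_def residue_ring_def Pi_def)

lemma reduce_UP_hom:
  assumes p: "p > 1" "p dvd q" "q > 1"
  shows "reduce_UP p \<in> Ring.ring_hom (UP (Zmod q)) (UP (Zmod p))"
proof (rule ring_hom_memI)
  interpret q: residues "int q" "Zmod q" using p by unfold_locales auto
  interpret p: residues "int p" "Zmod p" using p by unfold_locales auto
  \<comment> \<open>Since \<open>p\<close> divides \<open>q\<close>, the remainders modulo
    \<open>q\<close> taken by the operations are invisible modulo \<open>p\<close>.\<close>
  have dvd: "int p dvd int q" using p by simp
  fix f assume f: "f \<in> carrier (UP (Zmod q))"
  show cl: "reduce_UP p f \<in> carrier (UP (Zmod p))" if f: "f \<in> carrier (UP (Zmod q))" for f
    using p f unfolding in_UP_Zmod[OF p(1)] in_UP_Zmod[OF p(3)]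
    by (auto simp: reduce_UP_def) (metis mod_0)
  fix g assume g: "g \<in> carrier (UP (Zmod q))"
  show "reduce_UP p (f \<oplus>\<^bsub>UP (Zmod q)\<^esub> g) = reduce_UP p f \<oplus>\<^bsub>UP (Zmod p)\<^esub> reduce_UP p g"
    by (rule ext) (use f g cl dvd in \<open>simp add: UP_ops reduce_UP_def residue_ring_def mod_mod_cancel mod_simps\<close>)
  show "reduce_UP p (f \<otimes>\<^bsub>UP (Zmod q)\<^esub> g) = reduce_UP p f \<otimes>\<^bsub>UP (Zmod p)\<^esub> reduce_UP p g"
  proof (rule ext)
    fix i
    have "(f \<otimes>\<^bsub>UP (Zmod q)\<^esub> g) i = (\<Sum>j\<le>i. f j * g (i - j) mod int q) mod int q"
      using f g p by (simp add: UP_ops q.res_mult_eq) (subst finsum_residue_ring, auto)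
    also have "\<dots> mod int p = (\<Sum>j\<le>i. f j * g (i - j)) mod int p"
      using dvd by (simp add: mod_sum_eq mod_mod_cancel)
    finally have "(f \<otimes>\<^bsub>UP (Zmod q)\<^esub> g) i mod int p = (\<Sum>j\<le>i. f j * g (i - j)) mod int p" .
    moreover have "(reduce_UP p f \<otimes>\<^bsub>UP (Zmod p)\<^esub> reduce_UP p g) i =
        (\<Sum>j\<le>i. reduce_UP p f j * reduce_UP p g (i - j) mod int p) mod int p"
      using cl[OF f] cl[OF g] p by (simp add: UP_ops p.res_mult_eq) (subst finsum_residue_ring, auto)
    ultimately show "reduce_UP p (f \<otimes>\<^bsub>UP (Zmod q)\<^esub> g) i = (reduce_UP p f \<otimes>\<^bsub>UP (Zmod p)\<^esub> reduce_UP p g) i"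
      by (simp add: reduce_UP_def mod_mult_eq mod_sum_eq)
  qed
next
  show "reduce_UP p \<one>\<^bsub>UP (Zmod q)\<^esub> = \<one>\<^bsub>UP (Zmod p)\<^esub>"
    using p by (auto simp: reduce_UP_def UP_0_1 residue_ring_def)
qed

text \<open>The representatives from 0 to \<open>p - 1\<close> also represent classes modulo
  \<open>q\<close>, so a polynomial modulo \<open>p\<close> serves as its own lift. This is a
  section of sets only, in general not additive.\<close>

lemma reduce_UP_surj:
  assumes p: "p > 1" "p dvd q" "q > 1" and f: "f \<in> carrier (UP (Zmod p))"
  shows "f \<in> carrier (UP (Zmod q))" "reduce_UP p f = f"
proof -
  have "p \<le> q" using p by (intro dvd_imp_le) auto
  then show "f \<in> carrier (UP (Zmod q))" "reduce_UP p f = f"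
    using f unfolding in_UP_Zmod[OF p(1)] in_UP_Zmod[OF p(3)]
    by (auto simp: reduce_UP_def fun_eq_iff) (meson less_le_trans of_nat_le_iff)
qed

lemma reduce_UP_ker:
  assumes p: "p > 1" "p dvd q" "q > 1" and f: "f \<in> carrier (UP (Zmod q))"
    and 0: "reduce_UP p f = \<zero>\<^bsub>UP (Zmod p)\<^esub>"
  obtains g where "g \<in> carrier (UP (Zmod q))" "f = add_pow (UP (Zmod q)) (int p) g"
proof
  \<comment> \<open>Each coefficient is a nonnegative multiple of \<open>p\<close>, so exact integer
    division stays within the range modulo \<open>q\<close>.\<close>
  let ?g = "\<lambda>j. f j div int p"
  have *: "int p * ?g j = f j" for j
    using fun_cong[OF 0, of j] mult_div_mod_eq[of "int p" "f j"]
    by (simp add: reduce_UP_def UP_0_1 residue_ring_def)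
  have nonneg: "0 \<le> ?g j" for j
    using f p unfolding in_UP_Zmod[OF p(3)] by (simp add: pos_imp_zdiv_nonneg_iff)
  have le: "?g j \<le> f j" for j
    using mult_right_mono[OF _ nonneg, of 1 "int p" j] p * by simp
  show g: "?g \<in> carrier (UP (Zmod q))" using f unfolding in_UP_Zmod[OF p(3)]
    using nonneg le le_less_trans div_0 by metis
  show "f = add_pow (UP (Zmod q)) (int p) ?g"
    using f unfolding in_UP_Zmod[OF p(3)] by (intro ext) (simp add: add_pow_UP_Zmod[OF p(3) g] *)
qed

lemma quotient_hom_extends:
  assumes "ring R" "ring S" and J: "ideal J R" and \<Phi>: "\<Phi> \<in> Ring.ring_hom R S"
    and 0: "\<And>j. j \<in> J \<Longrightarrow> \<Phi> j = \<zero>\<^bsub>S\<^esub>"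
  obtains \<pi> where "\<pi> \<in> Ring.ring_hom (R Quot J) S"
    "\<And>x. x \<in> carrier R \<Longrightarrow> \<pi> (J +>\<^bsub>R\<^esub> x) = \<Phi> x"
proof -
  interpret R: ring R by fact
  interpret S: ring S by fact
  interpret \<Phi>: ring_hom_ring R S \<Phi>
    using \<Phi> by (intro ring_hom_ringI2) (auto simp: R.ring_axioms S.ring_axioms)
  \<comment> \<open>Any representative of the coset will do: two of them differ by an element of
    \<open>J\<close>, on which \<Phi> vanishes.\<close>
  define \<pi> where "\<pi> X = \<Phi> (SOME x. x \<in> carrier R \<and> J +>\<^bsub>R\<^esub> x = X)" for X
  have \<pi>: "\<pi> (J +>\<^bsub>R\<^esub> x) = \<Phi> x" if x: "x \<in> carrier R" for x
  proof -
    define y where "y = (SOME y. y \<in> carrier R \<and> J +>\<^bsub>R\<^esub> y = J +>\<^bsub>R\<^esub> x)"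
    have y: "y \<in> carrier R \<and> J +>\<^bsub>R\<^esub> y = J +>\<^bsub>R\<^esub> x"
      unfolding y_def by (rule someI[of _ x]) (use x in auto)
    then have "y \<ominus>\<^bsub>R\<^esub> x \<in> J" using R.quotient_eq_iff_same_a_r_cos[OF J, of y x] x by blast
    then have "\<Phi> (y \<ominus>\<^bsub>R\<^esub> x) = \<zero>\<^bsub>S\<^esub>" by (rule 0)
    then have "\<Phi> y \<ominus>\<^bsub>S\<^esub> \<Phi> x = \<zero>\<^bsub>S\<^esub>" using x y by (simp add: a_minus_def)
    then have "\<Phi> y = \<Phi> x" using x y by simp
    then show ?thesis by (simp add: \<pi>_def y_def)
  qed
  have car: "carrier (R Quot J) = (\<lambda>x. J +>\<^bsub>R\<^esub> x) ` carrier R"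
    by (auto simp: FactRing_def A_RCOSETS_def')
  note cos = ideal.rcos_ring_hom[OF J]
  have "\<pi> \<in> Ring.ring_hom (R Quot J) S"
  proof (rule ring_hom_memI)
    fix X Y assume "X \<in> carrier (R Quot J)" "Y \<in> carrier (R Quot J)"
    then obtain x y where xy: "x \<in> carrier R" "y \<in> carrier R" "X = J +>\<^bsub>R\<^esub> x" "Y = J +>\<^bsub>R\<^esub> y"
      unfolding car by blast
    show "\<pi> X \<in> carrier S" using xy by (simp add: \<pi>)
    show "\<pi> (X \<otimes>\<^bsub>R Quot J\<^esub> Y) = \<pi> X \<otimes>\<^bsub>S\<^esub> \<pi> Y"
      using ring_hom_mult[OF cos xy(1,2)] xy by (simp add: \<pi> flip: ring_hom_mult[OF cos])
    show "\<pi> (X \<oplus>\<^bsub>R Quot J\<^esub> Y) = \<pi> X \<oplus>\<^bsub>S\<^esub> \<pi> Y"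
      using ring_hom_add[OF cos xy(1,2)] xy by (simp add: \<pi> flip: ring_hom_add[OF cos])
  next
    show "\<pi> \<one>\<^bsub>R Quot J\<^esub> = \<one>\<^bsub>S\<^esub>"
      using ring_hom_one[OF cos] \<pi>[OF R.one_closed] by simp
  qed
  then show ?thesis using \<pi> that by blast
qed

section \<open>Finite fields and polynomials over them\<close>

lemma (in field) finite_field_pow_card:
  assumes "finite (carrier R)" "x \<in> carrier R"
  shows "x [^] card (carrier R) = x"
proof (cases "x = \<zero>")
  case True
  \<comment> \<open>The exponent must not be 0 here, as the power of zero with exponent 0 is the
    unit.\<close>
  have "card (carrier R) \<noteq> 0" using assms by auto
  then show ?thesis using True by (simp add: nat_pow_zero)
next
  case False
  interpret M: group "Multiplicative_Group.mult_of R" by (rule field_mult_group)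
  have "x [^]\<^bsub>Multiplicative_Group.mult_of R\<^esub> order (Multiplicative_Group.mult_of R) = \<one>"
    using M.pow_order_eq_1[of x] False assms by simp
  then have 1: "x [^] (card (carrier R) - 1) = \<one>"
    using assms by (simp add: order_mult_of order_def Multiplicative_Group.nat_pow_mult_of)
  have "card (carrier R) = Suc (card (carrier R) - 1)"
    using assms by (metis Suc_pred' card_gt_0_iff empty_iff)
  then have "x [^] card (carrier R) = x [^] (card (carrier R) - 1) \<otimes> x"
    using nat_pow_Suc by metis
  then show ?thesis using 1 assms by simp
qed

lemma (in domain) nat_pow_eq_zero:
  assumes "x \<in> carrier R" "x [^] (n::nat) = \<zero>"
  shows "x = \<zero>"
  using assms(2) by (induction n) (use assms(1) integral in auto)

text \<open>By Lagrange in the additive group, \<open>p ^ m\<close> times the unit is zero. The same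
  element is the \<open>m\<close>-th power of \<open>p\<close> times the unit, and a domain has no
  nonzero nilpotents.\<close>

lemma (in domain) add_pow_prime_zero:
  assumes "card (carrier R) = p ^ m" "p > 0" "x \<in> carrier R"
  shows "add_pow R (int p) x = \<zero>"
proof -
  have fin: "finite (carrier R)" using assms card_gt_0_iff[of "carrier R"] by simp
  have "add_pow R (card (carrier R)) \<one> = \<zero>"
    using add.pow_order_eq_1[of \<one>] fin by (simp add: order_def)
  then have 0: "add_pow R (int p ^ m) \<one> = \<zero>"
    using assms(1) by (simp add: add_pow_int_ge nat_power_eq)
  have "add_pow R (int p ^ k) \<one> = (add_pow R (int p) \<one>) [^] k" for k
  proof (induction k)
    case (Suc k)
    have "add_pow R (int p ^ Suc k) \<one> = add_pow R (int p) (add_pow R (int p ^ k) \<one>)"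
      by (simp add: add.int_pow_pow mult.commute)
    also have "\<dots> = add_pow R (int p ^ k) \<one> \<otimes> add_pow R (int p) \<one>"
      by (simp add: add_pow_rdistr_int)
    finally show ?case using Suc by simp
  qed simp
  then have "(add_pow R (int p) \<one>) [^] m = \<zero>" using 0 by simp
  then have "add_pow R (int p) \<one> = \<zero>" by (rule nat_pow_eq_zero[rotated]) simp
  then show ?thesis using assms(3) add_pow_ldistr_int[of \<one> x "int p"] by simp
qed

text \<open>Provides the coefficient map under which polynomials modulo \<open>p\<close> are
  evaluated at elements of \<open>K\<close>.\<close>

lemma (in ring) int_embed_hom:
  assumes "q > 1" "add_pow R (int q) \<one> = \<zero>"
  shows "(\<lambda>k::int. add_pow R k \<one>) \<in> Ring.ring_hom (Zmod q) R"
proof -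
  have md: "add_pow R (k mod int q) \<one> = add_pow R k \<one>" for k
  proof -
    have "add_pow R k \<one> = add_pow R (k mod int q + int q * (k div int q)) \<one>" by simp
    also have "\<dots> = add_pow R (k mod int q) \<one>"
      by (simp only: add.int_pow_mult one_closed) (simp add: add.int_pow_pow[symmetric] mult.commute assms)
    finally show ?thesis by simp
  qed
  show ?thesis
    by (rule ring_hom_memI)
      (auto simp: residue_ring_def md add.int_pow_mult add_pow_ldistr_int add_pow_rdistr_int add.int_pow_pow mult.commute)
qed

text \<open>The Euclidean structure serves to turn an irreducible polynomial into the generator of a
  maximal ideal.\<close>

lemma (in field) UP_euclidean_domain: "euclidean_domain (UP R) (deg R)"
proof -
  interpret U: UP_domain R "UP R" by unfold_locales
  show ?thesis
  proof (rule domain.euclidean_domainI[OF U.UP_domain])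
    fix a b assume a: "a \<in> carrier (UP R) - {\<zero>\<^bsub>UP R\<^esub>}" and b: "b \<in> carrier (UP R) - {\<zero>\<^bsub>UP R\<^esub>}"
    define l where "l = up_ring.coeff (UP R) b (deg R b)"
    have l: "l \<in> carrier R" "l \<noteq> \<zero>" using b by (auto simp: l_def U.lcoeff_nonzero simp del: up_coeff)
    obtain q r k where d: "q \<in> carrier (UP R)" "r \<in> carrier (UP R)"
      "l [^] (k::nat) \<odot>\<^bsub>UP R\<^esub> a = b \<otimes>\<^bsub>UP R\<^esub> q \<oplus>\<^bsub>UP R\<^esub> r" "r = \<zero>\<^bsub>UP R\<^esub> \<or> deg R r < deg R b"
      using U.long_div_theorem[of b a] a b unfolding l_def by blast
    \<comment> \<open>Long division applies to \<open>a\<close> scaled by a power of the leading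
      coefficient of \<open>b\<close>; over a field \<open>c\<close> undoes the scaling.\<close>
    define c where "c = inv (l [^] k)"
    have lk: "l [^] k \<in> Units R" using l field_Units by (auto dest: nat_pow_eq_zero)
    then have c: "c \<in> carrier R" "c \<otimes> l [^] k = \<one>" by (simp_all add: c_def)
    have "a = c \<odot>\<^bsub>UP R\<^esub> (l [^] k \<odot>\<^bsub>UP R\<^esub> a)"
      using c l a by (simp flip: U.UP_smult_assoc1)
    also have "\<dots> = b \<otimes>\<^bsub>UP R\<^esub> (c \<odot>\<^bsub>UP R\<^esub> q) \<oplus>\<^bsub>UP R\<^esub> c \<odot>\<^bsub>UP R\<^esub> r"
      unfolding d(3) using c b d U.UP_smult_assoc2[of c q b] U.P.m_comm[of b q] U.P.m_comm[of b "c \<odot>\<^bsub>UP R\<^esub> q"]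
      by (simp add: U.UP_smult_r_distr)
    finally have "a = b \<otimes>\<^bsub>UP R\<^esub> (c \<odot>\<^bsub>UP R\<^esub> q) \<oplus>\<^bsub>UP R\<^esub> c \<odot>\<^bsub>UP R\<^esub> r" .
    moreover have "c \<odot>\<^bsub>UP R\<^esub> r = \<zero>\<^bsub>UP R\<^esub> \<or> deg R (c \<odot>\<^bsub>UP R\<^esub> r) < deg R b"
      using d c U.deg_smult_ring[of c r] by (auto split: if_splits)
    ultimately show "\<exists>q r. q \<in> carrier (UP R) \<and> r \<in> carrier (UP R) \<and> a = b \<otimes>\<^bsub>UP R\<^esub> q \<oplus>\<^bsub>UP R\<^esub> r \<and>
      (r = \<zero>\<^bsub>UP R\<^esub> \<or> deg R r < deg R b)"
      by (intro exI[of _ "c \<odot>\<^bsub>UP R\<^esub> q"] exI[of _ "c \<odot>\<^bsub>UP R\<^esub> r"]) (use c d in simp)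
  qed
qed

text \<open>The polynomials of degree below that of \<open>g\<close> form a transversal of the
  ideal, and each is a free choice of that many coefficients. The count is what later makes an
  embedding of fields surjective.\<close>

lemma card_monic_quotient:
  fixes p :: nat
  assumes "prime p" and g: "monic_UP (Zmod p) g" and m: "0 < deg (Zmod p) g"
  shows "card (carrier (UP (Zmod p) Quot (Idl\<^bsub>UP (Zmod p)\<^esub> {g}))) = p ^ deg (Zmod p) g"
proof -
  have p: "p > 1" using assms(1) prime_gt_1_nat by simp
  let ?F = "UP (Zmod p)" let ?m = "deg (Zmod p) g" let ?I = "Idl\<^bsub>UP (Zmod p)\<^esub> {g}"
  interpret residues "int p" "Zmod p" using p by unfold_locales auto
  interpret U: UP_cring "Zmod p" ?F using Zmod_UP_cring[OF p] by simp
  have gF: "g \<in> carrier ?F" using g by (simp add: monic_UP_def)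
  have I: "ideal ?I ?F" "?I = PIdl\<^bsub>?F\<^esub> g"
    using gF by (auto intro: U.P.genideal_ideal simp: U.P.cgenideal_eq_genideal)
  define D where "D = {f \<in> carrier ?F. \<forall>j\<ge>?m. f j = 0}"
  have degD: "f \<in> D \<longleftrightarrow> f \<in> carrier ?F \<and> deg (Zmod p) f < ?m" for f
  proof
    assume f: "f \<in> D"
    have "deg (Zmod p) f \<le> ?m - 1"
      by (rule U.deg_aboveI) (use f m in \<open>auto simp: D_def res_zero_eq\<close>)
    then show "f \<in> carrier ?F \<and> deg (Zmod p) f < ?m" using f m by (auto simp: D_def)
  next
    assume "f \<in> carrier ?F \<and> deg (Zmod p) f < ?m"
    then show "f \<in> D" using U.deg_aboveD[of f] by (auto simp: D_def res_zero_eq)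
  qed
  have "bij_betw (\<lambda>f. restrict f {..<?m}) D ({..<?m} \<rightarrow>\<^sub>E {0..<int p})"
  proof (rule bij_betw_byWitness[where f' = "\<lambda>f j. if j < ?m then f j else 0"])
    show "\<forall>f\<in>D. (\<lambda>j. if j < ?m then restrict f {..<?m} j else 0) = f"
      by (auto simp: D_def fun_eq_iff)
    show "\<forall>f\<in>{..<?m} \<rightarrow>\<^sub>E {0..<int p}. restrict (\<lambda>j. if j < ?m then f j else 0) {..<?m} = f"
      by (auto simp: fun_eq_iff PiE_def extensional_def)
    show "(\<lambda>f. restrict f {..<?m}) ` D \<subseteq> {..<?m} \<rightarrow>\<^sub>E {0..<int p}"
      using in_UP_Zmod[OF p] by (auto simp: D_def split: if_splits)
    show "(\<lambda>f j. if j < ?m then f j else 0) ` ({..<?m} \<rightarrow>\<^sub>E {0..<int p}) \<subseteq> D"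
    proof
      fix x assume "x \<in> (\<lambda>f j. if j < ?m then f j else 0) ` ({..<?m} \<rightarrow>\<^sub>E {0..<int p})"
      then obtain f where f: "f \<in> {..<?m} \<rightarrow>\<^sub>E {0..<int p}" "x = (\<lambda>j. if j < ?m then f j else 0)"
        by blast
      have "f j \<in> {0..<int p}" if "j < ?m" for j using PiE_mem[OF f(1)] that by simp
      then show "x \<in> D" using p unfolding D_def in_UP_Zmod[OF p] f(2)
        by (auto intro!: exI[of _ ?m])
    qed
  qed
  then have "card D = card ({..<?m} \<rightarrow>\<^sub>E {0..<int p})" by (rule bij_betw_same_card)
  also have "\<dots> = p ^ ?m" by (simp add: card_PiE)
  finally have cD: "card D = p ^ ?m" .
  have "bij_betw (\<lambda>f. ?I +>\<^bsub>?F\<^esub> f) D (carrier (?F Quot ?I))"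
    unfolding bij_betw_def
  proof
    show "inj_on (\<lambda>f. ?I +>\<^bsub>?F\<^esub> f) D"
    proof (rule inj_onI)
      fix a b assume a: "a \<in> D" and b: "b \<in> D" and "?I +>\<^bsub>?F\<^esub> a = ?I +>\<^bsub>?F\<^esub> b"
      then have "a \<ominus>\<^bsub>?F\<^esub> b \<in> ?I"
        using U.P.quotient_eq_iff_same_a_r_cos[OF I(1)] by (auto simp: D_def)
      then obtain t where t: "t \<in> carrier ?F" "a \<ominus>\<^bsub>?F\<^esub> b = t \<otimes>\<^bsub>?F\<^esub> g"
        by (auto simp: I(2) cgenideal_def)
      then have ab: "a \<ominus>\<^bsub>?F\<^esub> b = g \<otimes>\<^bsub>?F\<^esub> t" using gF by (simp add: U.P.m_comm)
      have "deg (Zmod p) (a \<ominus>\<^bsub>?F\<^esub> b) < ?m"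
        using a b unfolding a_minus_def by (intro le_less_trans[OF U.deg_add]) (auto simp: degD)
      \<comment> \<open>A nonzero \<open>t\<close> would give the product at least the degree of
        \<open>g\<close>.\<close>
      then have "t = \<zero>\<^bsub>?F\<^esub>" using U.monic_mult_deg(2)[OF g t(1)] by (fastforce simp: ab)
      then have "a \<ominus>\<^bsub>?F\<^esub> b = \<zero>\<^bsub>?F\<^esub>" using ab gF by simp
      then show "a = b" using a b by (simp add: degD)
    qed
    show "(\<lambda>f. ?I +>\<^bsub>?F\<^esub> f) ` D = carrier (?F Quot ?I)"
    proof
      show "(\<lambda>f. ?I +>\<^bsub>?F\<^esub> f) ` D \<subseteq> carrier (?F Quot ?I)"
        by (auto simp: D_def FactRing_def A_RCOSETS_def')
      show "carrier (?F Quot ?I) \<subseteq> (\<lambda>f. ?I +>\<^bsub>?F\<^esub> f) ` D"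
      proof
        fix X assume "X \<in> carrier (?F Quot ?I)"
        then obtain f where f: "f \<in> carrier ?F" "X = ?I +>\<^bsub>?F\<^esub> f" by (auto simp: FactRing_def A_RCOSETS_def')
        obtain a b where ab: "a \<in> carrier ?F" "b \<in> carrier ?F" "f = g \<otimes>\<^bsub>?F\<^esub> a \<oplus>\<^bsub>?F\<^esub> b" "deg (Zmod p) b < ?m"
          using U.monic_division[OF g f(1) m] by blast
        have "f \<ominus>\<^bsub>?F\<^esub> b = a \<otimes>\<^bsub>?F\<^esub> g"
          using ab gF by (simp add: a_minus_def U.P.a_assoc U.P.r_neg U.P.m_comm)
        then have "f \<ominus>\<^bsub>?F\<^esub> b \<in> ?I" using ab by (auto simp: I(2) cgenideal_def)
        then have "X = ?I +>\<^bsub>?F\<^esub> b" using U.P.quotient_eq_iff_same_a_r_cos[OF I(1)] f ab by blast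
        then show "X \<in> (\<lambda>f. ?I +>\<^bsub>?F\<^esub> f) ` D" using ab by (simp add: degD)
      qed
    qed
  qed
  then show ?thesis using cD bij_betw_same_card by metis
qed

lemma mem_a_kernel: "x \<in> a_kernel R S f \<longleftrightarrow> x \<in> carrier R \<and> f x = \<zero>\<^bsub>S\<^esub>"
  by (simp add: a_kernel_def')

text \<open>With \<open>q = card (carrier K)\<close>, the polynomial \<open>X ^ q - X\<close> is a multiple \<open>g \<cdot> t\<close> of \<open>g\<close>, as it vanishes in the
  field of \<open>q\<close> elements defined by \<open>g\<close>. It vanishes on all of \<open>K\<close>, where \<open>t\<close> has fewer than \<open>q\<close> roots;
  hence \<open>g\<close> has a root in \<open>K\<close>.\<close>

lemma finite_field_quotient_hom:
  fixes p :: nat and K :: "('k, 's) ring_scheme"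
  assumes p: "prime p" and g: "monic_UP (Zmod p) g" and irr: "ring_irreducible\<^bsub>UP (Zmod p)\<^esub> g"
    and m: "0 < deg (Zmod p) g" and K: "field K" "card (carrier K) = p ^ deg (Zmod p) g"
  obtains \<Phi> where "\<Phi> \<in> Ring.ring_hom (UP (Zmod p)) K" "\<Phi> ` carrier (UP (Zmod p)) = carrier K"
    "\<And>f. f \<in> carrier (UP (Zmod p)) \<Longrightarrow> \<Phi> f = \<zero>\<^bsub>K\<^esub> \<longleftrightarrow> f \<in> Idl\<^bsub>UP (Zmod p)\<^esub> {g}"
proof -
  have p1: "p > 1" using p prime_gt_1_nat by simp
  let ?F = "UP (Zmod p)" let ?m = "deg (Zmod p) g" let ?I = "Idl\<^bsub>UP (Zmod p)\<^esub> {g}"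
  let ?q = "p ^ ?m" let ?L = "?F Quot ?I"
  interpret Z: residues_prime p "Zmod p" using p by unfold_locales
  have Zf: "field (Zmod p)" by (rule Z.is_field)
  interpret U: UP_domain "Zmod p" ?F using field.axioms(1)[OF Zf] by (simp add: UP_domain_def)
  interpret K: field K by fact
  interpret UK: UP_domain K "UP K" by unfold_locales
  interpret E: euclidean_domain ?F "deg (Zmod p)" by (rule field.UP_euclidean_domain[OF Zf])
  have gF: "g \<in> carrier ?F" using g by (simp add: monic_UP_def)
  have I: "?I = PIdl\<^bsub>?F\<^esub> g" using U.P.cgenideal_eq_genideal[OF gF] by simp
  interpret I: maximalideal ?I ?F
    unfolding I by (rule E.irreducible_imp_maximalideal[OF gF irr])
  interpret L: field ?L by (rule I.quotient_is_field) (rule U.P.is_cring)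
  have cL: "card (carrier ?L) = ?q" by (rule card_monic_quotient[OF p g m])
  have q1: "?q > 1" using p1 m by (intro one_less_power) auto
  have fL: "finite (carrier ?L)" using cL q1 p1 by (intro card_ge_0_finite) simp
  have fK: "finite (carrier K)" using K q1 p1 by (intro card_ge_0_finite) simp
  have pK: "add_pow K (int p) x = \<zero>\<^bsub>K\<^esub>" if "x \<in> carrier K" for x
    by (rule K.add_pow_prime_zero[OF K(2)]) (use p1 that in auto)
  define \<iota> where "\<iota> k = add_pow K (k::int) \<one>\<^bsub>K\<^esub>" for k
  have \<iota>: "\<iota> \<in> Ring.ring_hom (Zmod p) K"
    unfolding \<iota>_def by (rule K.int_embed_hom[OF p1]) (simp add: pK)
  interpret \<iota>: ring_hom_cring "Zmod p" K \<iota>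
    using \<iota> by (intro ring_hom_cringI) (auto simp: Z.cring K.is_cring)
  \<comment> \<open>Nonzero coefficients stay nonzero, which is needed for \<open>t\<close> to keep
    its degree over \<open>K\<close>.\<close>
  have \<iota>0: "\<iota> k \<noteq> \<zero>\<^bsub>K\<^esub>" if "k \<in> carrier (Zmod p)" "k \<noteq> \<zero>\<^bsub>Zmod p\<^esub>" for k
  proof
    assume 0: "\<iota> k = \<zero>\<^bsub>K\<^esub>"
    have "k \<in> Units (Zmod p)" using that field.field_Units[OF Zf] by auto
    then have "inv\<^bsub>Zmod p\<^esub> k \<otimes>\<^bsub>Zmod p\<^esub> k = \<one>\<^bsub>Zmod p\<^esub>" "inv\<^bsub>Zmod p\<^esub> k \<in> carrier (Zmod p)" by auto
    then have "\<iota> (inv\<^bsub>Zmod p\<^esub> k) \<otimes>\<^bsub>K\<^esub> \<iota> k = \<one>\<^bsub>K\<^esub>" using that by (metis \<iota>.hom_mult \<iota>.hom_one)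
    then show False using 0 \<open>inv\<^bsub>Zmod p\<^esub> k \<in> carrier (Zmod p)\<close> by simp
  qed
  interpret ev: UP_pre_univ_prop "Zmod p" K \<iota> ?F by unfold_locales
  define ev where "ev \<alpha> = eval (Zmod p) K \<iota> \<alpha>" for \<alpha>
  have ev_hom: "ev \<alpha> \<in> Ring.ring_hom ?F K" if "\<alpha> \<in> carrier K" for \<alpha>
    unfolding ev_def by (rule ev.eval_ring_hom[OF that])
  define X where "X = up_ring.monom ?F \<one>\<^bsub>Zmod p\<^esub> 1"
  have X: "X \<in> carrier ?F" by (simp add: X_def)
  define w where "w = X [^]\<^bsub>?F\<^esub> ?q \<ominus>\<^bsub>?F\<^esub> X"
  have w: "w \<in> carrier ?F" using X by (simp add: w_def)
  have Xq: "X [^]\<^bsub>?F\<^esub> ?q = up_ring.monom ?F \<one>\<^bsub>Zmod p\<^esub> ?q"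
    unfolding X_def by (subst U.monom_pow) auto
  have wI: "w \<in> ?I"
  proof -
    interpret cos: ring_hom_cring ?F ?L "(+>\<^bsub>?F\<^esub>) ?I" by (rule I.rcos_ring_hom_cring[OF U.P.is_cring])
    have "?I +>\<^bsub>?F\<^esub> (X [^]\<^bsub>?F\<^esub> ?q) = (?I +>\<^bsub>?F\<^esub> X) [^]\<^bsub>?L\<^esub> ?q"
      using X by simp
    also have "\<dots> = ?I +>\<^bsub>?F\<^esub> X"
      using L.finite_field_pow_card[OF fL, of "?I +>\<^bsub>?F\<^esub> X"] X cL by simp
    finally show ?thesis unfolding w_def
      using U.P.quotient_eq_iff_same_a_r_cos[OF I.ideal_axioms] X by (simp add: U.P.nat_pow_closed)
  qed
  have w0: "w \<noteq> \<zero>\<^bsub>?F\<^esub>"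
  proof
    assume "w = \<zero>\<^bsub>?F\<^esub>"
    then have "up_ring.coeff ?F w ?q = \<zero>\<^bsub>Zmod p\<^esub>" by (simp add: UP_0_1)
    moreover have "up_ring.coeff ?F w ?q = \<one>\<^bsub>Zmod p\<^esub>"
      unfolding w_def Xq unfolding X_def using q1 by (simp add: U.coeff_minus a_minus_def del: up_coeff)
    ultimately show False by (simp add: Z.res_one_eq Z.res_zero_eq)
  qed
  have degw: "deg (Zmod p) w \<le> ?q"
    unfolding w_def Xq unfolding X_def
    by (rule U.deg_aboveI) (use q1 in \<open>simp_all add: U.coeff_minus a_minus_def del: up_coeff\<close>)
  obtain t where t: "t \<in> carrier ?F" "w = t \<otimes>\<^bsub>?F\<^esub> g"
    using wI unfolding I by (auto simp: cgenideal_def)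
  have wt: "w = g \<otimes>\<^bsub>?F\<^esub> t" using t gF by (simp add: U.P.m_comm)
  have t0: "t \<noteq> \<zero>\<^bsub>?F\<^esub>" using w0 wt gF by auto
  have degt: "deg (Zmod p) t < ?q"
    using U.monic_mult_deg(2)[OF g t(1) t0] degw m unfolding wt by simp
  have ev_w: "ev \<alpha> w = \<zero>\<^bsub>K\<^esub>" if a: "\<alpha> \<in> carrier K" for \<alpha>
  proof -
    interpret h: ring_hom_cring ?F K "ev \<alpha>"
      using ev_hom[OF a] by (intro ring_hom_cringI) (auto simp: U.P.is_cring K.is_cring)
    have "ev \<alpha> X = \<alpha>" unfolding ev_def X_def by (rule ev.eval_monom1[OF a])
    then have "ev \<alpha> w = \<alpha> [^]\<^bsub>K\<^esub> ?q \<ominus>\<^bsub>K\<^esub> \<alpha>" using X by (simp add: w_def a_minus_def)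
    then show ?thesis using K.finite_field_pow_card[OF fK a] K(2) a by simp
  qed
  have "\<exists>\<alpha>\<in>carrier K. ev \<alpha> g = \<zero>\<^bsub>K\<^esub>"
  proof (rule ccontr)
    assume no: "\<not> (\<exists>\<alpha>\<in>carrier K. ev \<alpha> g = \<zero>\<^bsub>K\<^esub>)"
    have ev_t: "ev \<alpha> t = \<zero>\<^bsub>K\<^esub>" if a: "\<alpha> \<in> carrier K" for \<alpha>
    proof -
      have "ev \<alpha> t \<otimes>\<^bsub>K\<^esub> ev \<alpha> g = \<zero>\<^bsub>K\<^esub>"
        using ev_w[OF a] ring_hom_mult[OF ev_hom[OF a] t(1) gF] t(2) by simp
      then show ?thesis
        using no a K.integral ring_hom_closed[OF ev_hom[OF a]] t(1) gF by blast
    qed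
    \<comment> \<open>The bound on the number of roots concerns polynomials over the field in which
      the roots lie, so \<open>t\<close> is moved to \<open>UP K\<close>.\<close>
    define t' where "t' = (\<lambda>j. \<iota> (t j))"
    have t': "t' \<in> carrier (UP K)"
    proof -
      obtain n where n: "\<And>j. j > n \<Longrightarrow> t j = 0" using t(1) in_UP_Zmod[OF p1] by blast
      have "\<iota> 0 = \<zero>\<^bsub>K\<^esub>" by (simp add: \<iota>_def)
      then have "bound \<zero>\<^bsub>K\<^esub> n t'" using n by (auto simp: t'_def)
      moreover have "t' j \<in> carrier K" for j using UP_closed[OF t(1), of j] by (simp add: t'_def)
      ultimately show ?thesis by (auto simp: UP_def)
    qed
    have lc: "t (deg (Zmod p) t) \<noteq> \<zero>\<^bsub>Zmod p\<^esub>" using U.lcoeff_nonzero[OF t0 t(1)] t(1) by simp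
    have degt': "deg K t' = deg (Zmod p) t"
    proof (rule le_antisym[OF UK.deg_aboveI[OF _ t'] UK.deg_belowI[OF _ t']])
      fix j assume "deg (Zmod p) t < j"
      then have "t j = \<zero>\<^bsub>Zmod p\<^esub>" using U.deg_aboveD[of t j] t(1) by simp
      then show "up_ring.coeff (UP K) t' j = \<zero>\<^bsub>K\<^esub>" using t' by (simp add: t'_def)
    qed (use t' lc \<iota>0 UP_closed[OF t(1)] in \<open>simp add: t'_def\<close>)
    have t'0: "t' \<noteq> \<zero>\<^bsub>UP K\<^esub>"
    proof
      assume "t' = \<zero>\<^bsub>UP K\<^esub>"
      then have "t' (deg (Zmod p) t) = \<zero>\<^bsub>K\<^esub>" by (simp add: UP_0_1)
      then show False using lc \<iota>0 UP_closed[OF t(1)] by (simp add: t'_def)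
    qed
    \<comment> \<open>\<open>eval\<close> sums over coefficients up to the degree, so equality of
      the degrees makes both evaluations the same sum.\<close>
    have "eval K K id \<alpha> t' = \<zero>\<^bsub>K\<^esub>" if a: "\<alpha> \<in> carrier K" for \<alpha>
      using ev_t[OF a] t(1) t' by (simp add: ev_def eval_def degt') (simp add: t'_def)
    then have "{a \<in> carrier K. eval K K id a t' = \<zero>\<^bsub>K\<^esub>} = carrier K" by blast
    then have "card (carrier K) \<le> deg K t'" using UK.roots_bound[OF t' t'0 fK] by simp
    then show False using degt degt' K(2) by simp
  qed
  then obtain \<alpha> where \<alpha>: "\<alpha> \<in> carrier K" "ev \<alpha> g = \<zero>\<^bsub>K\<^esub>" by blast
  interpret h: ring_hom_ring ?F K "ev \<alpha>"
    using ev_hom[OF \<alpha>(1)] by (intro ring_hom_ringI2) (auto simp: U.P.ring_axioms K.ring_axioms)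
  \<comment> \<open>The kernel contains the maximal ideal of \<open>g\<close> and omits the unit, so
    it can only be that ideal.\<close>
  have ker: "a_kernel ?F K (ev \<alpha>) = ?I"
  proof -
    have "?I \<subseteq> a_kernel ?F K (ev \<alpha>)"
    proof
      fix x assume "x \<in> ?I"
      then obtain y where y: "y \<in> carrier ?F" "x = y \<otimes>\<^bsub>?F\<^esub> g" unfolding I cgenideal_def by blast
      then have "ev \<alpha> x = ev \<alpha> y \<otimes>\<^bsub>K\<^esub> \<zero>\<^bsub>K\<^esub>"
        using ring_hom_mult[OF ev_hom[OF \<alpha>(1)] y(1) gF] \<alpha>(2) by (simp only:)
      also have "\<dots> = \<zero>\<^bsub>K\<^esub>" by (rule K.r_null) (rule h.hom_closed[OF y(1)])
      finally show "x \<in> a_kernel ?F K (ev \<alpha>)"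
        unfolding mem_a_kernel using y U.P.m_closed[OF y(1) gF] by (simp only: simp_thms)
    qed
    moreover have "\<one>\<^bsub>?F\<^esub> \<notin> a_kernel ?F K (ev \<alpha>)"
      unfolding mem_a_kernel ring_hom_one[OF ev_hom[OF \<alpha>(1)]] using K.one_not_zero by blast
    moreover have "a_kernel ?F K (ev \<alpha>) \<subseteq> carrier ?F" by (rule subsetI) (simp only: mem_a_kernel)
    ultimately show ?thesis
      using I.I_maximal[OF h.kernel_is_ideal] U.P.one_closed by blast
  qed
  have ker': "ev \<alpha> f = \<zero>\<^bsub>K\<^esub> \<longleftrightarrow> f \<in> ?I" if "f \<in> carrier ?F" for f
    unfolding ker[symmetric] mem_a_kernel using that by (simp only: simp_thms)
  have I0: "ev \<alpha> j = \<zero>\<^bsub>K\<^esub>" if "j \<in> ?I" for j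
    using ker'[of j] I.a_subset that by blast
  obtain \<Lambda> where \<Lambda>: "\<Lambda> \<in> Ring.ring_hom ?L K" "\<And>x. x \<in> carrier ?F \<Longrightarrow> \<Lambda> (?I +>\<^bsub>?F\<^esub> x) = ev \<alpha> x"
    using quotient_hom_extends[OF U.P.ring_axioms K.ring_axioms I.ideal_axioms ev_hom[OF \<alpha>(1)] I0] by blast
  have carL: "carrier ?L = (\<lambda>x. ?I +>\<^bsub>?F\<^esub> x) ` carrier ?F" by (auto simp: FactRing_def A_RCOSETS_def')
  \<comment> \<open>With the kernel known, the induced map on the quotient is injective; both fields
    have the same finite cardinality, so it is onto, and hence so is
    \<open>ev \<alpha>\<close>.\<close>
  have "inj_on \<Lambda> (carrier ?L)"
  proof (rule inj_onI)
    fix A B assume "A \<in> carrier ?L" "B \<in> carrier ?L" and eq: "\<Lambda> A = \<Lambda> B"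
    then obtain a b where ab: "a \<in> carrier ?F" "b \<in> carrier ?F" "A = ?I +>\<^bsub>?F\<^esub> a" "B = ?I +>\<^bsub>?F\<^esub> b"
      unfolding carL by blast
    then have "ev \<alpha> (a \<ominus>\<^bsub>?F\<^esub> b) = \<zero>\<^bsub>K\<^esub>" using eq by (simp add: \<Lambda>(2) a_minus_def K.r_neg)
    then have "a \<ominus>\<^bsub>?F\<^esub> b \<in> ?I" using ker'[of "a \<ominus>\<^bsub>?F\<^esub> b"] ab by simp
    then show "A = B" using U.P.quotient_eq_iff_same_a_r_cos[OF I.ideal_axioms] ab by blast
  qed
  then have "card (\<Lambda> ` carrier ?L) = card (carrier K)" using cL K(2) by (simp add: card_image)
  moreover have "\<Lambda> ` carrier ?L \<subseteq> carrier K" using ring_hom_closed[OF \<Lambda>(1)] by auto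
  ultimately have "\<Lambda> ` carrier ?L = carrier K" using fK by (simp add: card_subset_eq)
  moreover have "\<Lambda> ` carrier ?L = ev \<alpha> ` carrier ?F"
    unfolding carL image_image by (rule image_cong) (auto simp: \<Lambda>(2))
  ultimately show ?thesis using that[OF ev_hom[OF \<alpha>(1)]] ker' by simp
qed

text \<open>Coefficients are reduced modulo \<open>p\<close> and the result is mapped onto
  \<open>K\<close> itself, not onto a chosen model of the residue field, so the lift fits the given
  Wedderburn decomposition directly. On polynomials the kernel is generated by \<open>h\<close> and
  \<open>p\<close>; modulo \<open>h\<close> only the multiples of \<open>p\<close> are left.\<close>

lemma p_lift_poly_quotient:
  fixes p :: nat and K :: "('k, 's) ring_scheme"
  assumes p: "prime p" and r: "1 \<le> r" and q: "q = p ^ r" and h: "monic_UP (Zmod q) h" "basic_irreducible p r h"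
    and m: "0 < deg (Zmod q) h" and K: "field K" "card (carrier K) = p ^ deg (Zmod q) h"
  shows "\<exists>\<pi>. p_lift (int p) r (poly_quotient (Zmod q) h) K \<pi>"
proof -
  let ?F = "UP (Zmod p)" let ?P = "UP (Zmod q)" let ?m = "deg (Zmod q) h" let ?J = "Idl\<^bsub>?P\<^esub> {h}"
  have p1: "p > 1" using p prime_gt_1_nat by simp
  have q1: "q > 1" unfolding q using p1 r by (intro one_less_power) auto
  have pq: "p dvd q" unfolding q using r by (simp add: dvd_power)
  have qi: "int q = int p ^ r" by (simp add: q)
  interpret Q: residues "int q" "Zmod q" using q1 by unfold_locales auto
  interpret Z: residues "int p" "Zmod p" using p1 by unfold_locales auto
  interpret P: UP_cring "Zmod q" ?P using Zmod_UP_cring[OF q1] by simp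
  interpret F: UP_cring "Zmod p" ?F using Zmod_UP_cring[OF p1] by simp
  interpret K: field K by fact
  define red where "red = reduce_UP p"
  have red_hom: "red \<in> Ring.ring_hom ?P ?F" unfolding red_def by (rule reduce_UP_hom[OF p1 pq q1])
  note red_closed = ring_hom_closed[OF red_hom]
  have hP: "h \<in> carrier ?P" "h ?m = 1" using h(1) by (auto simp: monic_UP_def Q.res_one_eq)
  define g where "g = red h"
  have gF: "g \<in> carrier ?F" using red_closed[OF hP(1)] by (simp add: g_def)
  have gm: "g ?m = 1" using hP p1 by (simp add: g_def red_def reduce_UP_def)
  \<comment> \<open>The leading coefficient 1 survives reduction, so the degree does not
    drop.\<close>
  have degg: "deg (Zmod p) g = ?m"
  proof (rule le_antisym[OF F.deg_aboveI[OF _ gF] F.deg_belowI[OF _ gF]])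
    fix j assume "?m < j"
    then have "h j = 0" using P.deg_aboveD[of h j] hP by (simp add: Q.res_zero_eq)
    then show "up_ring.coeff ?F g j = \<zero>\<^bsub>Zmod p\<^esub>"
      using gF by (simp add: g_def red_def reduce_UP_def Z.res_zero_eq)
  qed (use gm gF in \<open>simp add: Z.res_zero_eq\<close>)
  have gmon: "monic_UP (Zmod p) g" using gF gm by (simp add: monic_UP_def degg Z.res_one_eq)
  have girr: "ring_irreducible\<^bsub>?F\<^esub> g"
    using h(2) hP by (simp add: q[symmetric] basic_irreducible_def g_def red_def reduce_UP_def)
  obtain \<Phi> where \<Phi>: "\<Phi> \<in> Ring.ring_hom ?F K" "\<Phi> ` carrier ?F = carrier K"
    "\<And>f. f \<in> carrier ?F \<Longrightarrow> \<Phi> f = \<zero>\<^bsub>K\<^esub> \<longleftrightarrow> f \<in> Idl\<^bsub>?F\<^esub> {g}"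
    using finite_field_quotient_hom[OF p gmon girr _ K(1)] K(2) m degg by metis
  have I: "Idl\<^bsub>?F\<^esub> {g} = PIdl\<^bsub>?F\<^esub> g" using F.P.cgenideal_eq_genideal[OF gF] by simp
  have J: "?J = PIdl\<^bsub>?P\<^esub> h" using P.P.cgenideal_eq_genideal[OF hP(1)] by simp
  have Ji: "ideal ?J ?P" using hP by (auto intro: P.P.genideal_ideal)
  define \<Psi> where "\<Psi> = \<Phi> \<circ> red"
  have \<Psi>_hom: "\<Psi> \<in> Ring.ring_hom ?P K" unfolding \<Psi>_def by (rule ring_hom_trans[OF red_hom \<Phi>(1)])
  interpret \<Psi>: ring_hom_ring ?P K \<Psi>
    using \<Psi>_hom by (intro ring_hom_ringI2) (auto simp: P.P.ring_axioms K.ring_axioms)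
  have \<Psi>_ker: "\<Psi> f = \<zero>\<^bsub>K\<^esub> \<longleftrightarrow> (\<exists>t\<in>carrier ?F. red f = red h \<otimes>\<^bsub>?F\<^esub> t)" if f: "f \<in> carrier ?P" for f
    using \<Phi>(3)[OF red_closed[OF f]] gF unfolding I \<Psi>_def
    by (auto simp: cgenideal_def g_def F.P.m_comm)
  have memJ: "f \<in> ?J \<longleftrightarrow> (\<exists>t\<in>carrier ?P. f = h \<otimes>\<^bsub>?P\<^esub> t)" for f
    unfolding J using hP by (auto simp: cgenideal_def P.P.m_comm)
  have J0: "\<Psi> j = \<zero>\<^bsub>K\<^esub>" if j: "j \<in> ?J" for j
  proof -
    obtain t where t: "t \<in> carrier ?P" "j = h \<otimes>\<^bsub>?P\<^esub> t" using j unfolding memJ by blast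
    have "\<Psi> h = \<zero>\<^bsub>K\<^esub>"
      using \<Phi>(3)[OF gF] F.P.genideal_self'[OF gF] by (simp only: \<Psi>_def g_def comp_apply)
    then show ?thesis using t hP by simp
  qed
  let ?B = "poly_quotient (Zmod q) h"
  have B: "?B = ?P Quot ?J" by (simp add: poly_quotient_def)
  interpret B: ring ?B unfolding B by (rule ideal.quotient_is_ring[OF Ji])
  obtain \<pi> where \<pi>: "\<pi> \<in> Ring.ring_hom ?B K" "\<And>x. x \<in> carrier ?P \<Longrightarrow> \<pi> (?J +>\<^bsub>?P\<^esub> x) = \<Psi> x"
    using quotient_hom_extends[OF P.P.ring_axioms K.ring_axioms Ji \<Psi>_hom J0] unfolding B by blast
  have carB: "carrier ?B = (\<lambda>x. ?J +>\<^bsub>?P\<^esub> x) ` carrier ?P"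
    by (auto simp: B FactRing_def A_RCOSETS_def')
  have carE: "\<exists>f\<in>carrier ?P. b = ?J +>\<^bsub>?P\<^esub> f" if "b \<in> carrier ?B" for b
    using that by (simp only: carB image_iff)
  have cos: "(+>\<^bsub>?P\<^esub>) ?J \<in> Ring.ring_hom ?P ?B" unfolding B by (rule ideal.rcos_ring_hom[OF Ji])
  have cos_pow: "add_pow ?B (k::int) (?J +>\<^bsub>?P\<^esub> f) = ?J +>\<^bsub>?P\<^esub> add_pow ?P k f" if "f \<in> carrier ?P" for k f
    by (rule add_pow_hom[OF P.P.abelian_group_axioms B.abelian_group_axioms, symmetric])
      (use that ring_hom_add[OF cos] ring_hom_closed[OF cos] in auto)
  have cos_eq: "?J +>\<^bsub>?P\<^esub> a = ?J +>\<^bsub>?P\<^esub> b \<longleftrightarrow> a \<ominus>\<^bsub>?P\<^esub> b \<in> ?J" if "a \<in> carrier ?P" "b \<in> carrier ?P" for a b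
    using P.P.quotient_eq_iff_same_a_r_cos[OF Ji that] by simp
  have cos0: "\<zero>\<^bsub>?B\<^esub> = ?J +>\<^bsub>?P\<^esub> \<zero>\<^bsub>?P\<^esub>" using ring_hom_zero[OF cos P.P.ring_axioms B.ring_axioms] by simp
  have pK: "add_pow K (int p) x = \<zero>\<^bsub>K\<^esub>" if "x \<in> carrier K" for x
    by (rule K.add_pow_prime_zero[OF K(2)]) (use p1 that in auto)
  have surj: "\<pi> ` carrier ?B = carrier K"
  proof -
    have "red ` carrier ?P = carrier ?F"
    proof
      show "carrier ?F \<subseteq> red ` carrier ?P"
      proof
        fix f assume "f \<in> carrier ?F"
        then have "f \<in> carrier ?P" "red f = f"
          using reduce_UP_surj[OF p1 pq q1] by (auto simp: red_def)
        then show "f \<in> red ` carrier ?P" by (metis imageI)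
      qed
    qed (use red_closed in auto)
    then have "\<Psi> ` carrier ?P = carrier K" unfolding \<Psi>_def image_comp[symmetric] using \<Phi>(2) by simp
    moreover have "\<pi> ` carrier ?B = \<Psi> ` carrier ?P"
      unfolding carB image_image by (rule image_cong) (auto simp: \<pi>(2))
    ultimately show ?thesis by simp
  qed
  have ker: "\<pi> b = \<zero>\<^bsub>K\<^esub> \<longleftrightarrow> (\<exists>b'\<in>carrier ?B. b = add_pow ?B (int p) b')" if "b \<in> carrier ?B" for b
  proof
    assume 0: "\<pi> b = \<zero>\<^bsub>K\<^esub>"
    obtain f where f: "f \<in> carrier ?P" "b = ?J +>\<^bsub>?P\<^esub> f" using carE[OF \<open>b \<in> carrier ?B\<close>] by blast
    then obtain t where t: "t \<in> carrier ?F" "red f = red h \<otimes>\<^bsub>?F\<^esub> t" using 0 \<pi>(2) \<Psi>_ker by auto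
    \<comment> \<open>Here \<open>t\<close> is read modulo \<open>q\<close> as its own lift;
      \<open>f\<close> and \<open>h\<close> times \<open>t\<close> then have the same reduction and
      differ by a multiple of \<open>p\<close>.\<close>
    have tP: "t \<in> carrier ?P" "red t = t" using reduce_UP_surj[OF p1 pq q1 t(1)] by (auto simp: red_def)
    interpret red: ring_hom_ring ?P ?F red
      using red_hom by (intro ring_hom_ringI2) (auto simp: P.P.ring_axioms F.P.ring_axioms)
    have ht: "h \<otimes>\<^bsub>?P\<^esub> t \<in> carrier ?P" using hP tP by simp
    have "red (f \<ominus>\<^bsub>?P\<^esub> h \<otimes>\<^bsub>?P\<^esub> t) = \<zero>\<^bsub>?F\<^esub>"
      using f hP tP t(1) red_closed by (simp add: a_minus_def t(2) F.P.r_neg)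
    then obtain s where s: "s \<in> carrier ?P" "f \<ominus>\<^bsub>?P\<^esub> h \<otimes>\<^bsub>?P\<^esub> t = add_pow ?P (int p) s"
      using reduce_UP_ker[OF p1 pq q1, of "f \<ominus>\<^bsub>?P\<^esub> h \<otimes>\<^bsub>?P\<^esub> t"] f ht unfolding red_def by auto
    have "f \<ominus>\<^bsub>?P\<^esub> add_pow ?P (int p) s = h \<otimes>\<^bsub>?P\<^esub> t"
    proof -
      have "x \<ominus>\<^bsub>?P\<^esub> (x \<ominus>\<^bsub>?P\<^esub> y) = y" if "x \<in> carrier ?P" "y \<in> carrier ?P" for x y
        using that by (simp add: a_minus_def P.P.minus_add P.P.a_assoc[symmetric] P.P.r_neg)
      then show ?thesis unfolding s(2)[symmetric] using f ht by simp
    qed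
    then have "b = add_pow ?B (int p) (?J +>\<^bsub>?P\<^esub> s)"
      using f s tP memJ by (auto simp: cos_pow cos_eq)
    then show "\<exists>b'\<in>carrier ?B. b = add_pow ?B (int p) b'" using s ring_hom_closed[OF cos] by blast
  next
    assume "\<exists>b'\<in>carrier ?B. b = add_pow ?B (int p) b'"
    then obtain b' where b': "b' \<in> carrier ?B" "b = add_pow ?B (int p) b'" by blast
    have "\<pi> b = add_pow K (int p) (\<pi> b')" unfolding b'(2)
      by (rule add_pow_hom[OF B.abelian_group_axioms K.abelian_group_axioms])
        (use b' ring_hom_add[OF \<pi>(1)] ring_hom_closed[OF \<pi>(1)] in auto)
    then show "\<pi> b = \<zero>\<^bsub>K\<^esub>" using pK[OF ring_hom_closed[OF \<pi>(1) b'(1)]] by (simp only:)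
  qed
  have ann: "add_pow ?B (int p ^ r) b = \<zero>\<^bsub>?B\<^esub>" if b: "b \<in> carrier ?B" for b
  proof -
    obtain f where f: "f \<in> carrier ?P" "b = ?J +>\<^bsub>?P\<^esub> f" using carE[OF b] by blast
    have "add_pow ?P (int p ^ r) f = \<zero>\<^bsub>?P\<^esub>"
      by (rule ext) (simp add: add_pow_UP_Zmod[OF q1 f(1)] UP_0_1 Q.res_zero_eq qi[symmetric])
    then show ?thesis using f by (simp add: cos_pow cos0)
  qed
  have tors: "\<pi> b = \<zero>\<^bsub>K\<^esub>" if b: "b \<in> carrier ?B" "add_pow ?B (int p ^ (r - 1)) b = \<zero>\<^bsub>?B\<^esub>" for b
  proof -
    let ?k = "int p ^ (r - 1)"
    obtain f where f: "f \<in> carrier ?P" "b = ?J +>\<^bsub>?P\<^esub> f" using carE[OF b(1)] by blast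
    \<comment> \<open>Division by \<open>h\<close> picks the representative of low degree. Its
      multiple by \<open>p ^ (r - 1)\<close> lies in the ideal of \<open>h\<close> but still has low
      degree, so it vanishes as a polynomial, and divisibility by \<open>p\<close> can be read off
      each coefficient.\<close>
    obtain a c where ac: "a \<in> carrier ?P" "c \<in> carrier ?P" "f = h \<otimes>\<^bsub>?P\<^esub> a \<oplus>\<^bsub>?P\<^esub> c" "deg (Zmod q) c < ?m"
      using P.monic_division[OF h(1) f(1) m] by blast
    have "f \<ominus>\<^bsub>?P\<^esub> c = h \<otimes>\<^bsub>?P\<^esub> a" using ac hP by (simp add: a_minus_def P.P.a_assoc P.P.r_neg)
    then have bc: "b = ?J +>\<^bsub>?P\<^esub> c" using f ac memJ cos_eq by auto
    have kc: "add_pow ?P ?k c \<in> carrier ?P" using ac by simp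
    have "add_pow ?P ?k c \<ominus>\<^bsub>?P\<^esub> \<zero>\<^bsub>?P\<^esub> \<in> ?J"
      using b(2) ac kc unfolding bc cos0 by (simp only: cos_pow cos_eq P.P.zero_closed)
    then obtain t where t: "t \<in> carrier ?P" "add_pow ?P ?k c = h \<otimes>\<^bsub>?P\<^esub> t"
      using memJ kc by (auto simp: a_minus_def)
    have "deg (Zmod q) (add_pow ?P ?k c) \<le> deg (Zmod q) c"
    proof (rule P.deg_aboveI[OF _ kc])
      fix j assume "deg (Zmod q) c < j"
      then have "c j = 0" using P.deg_aboveD[of c j] ac by (simp add: Q.res_zero_eq)
      then show "up_ring.coeff ?P (add_pow ?P ?k c) j = \<zero>\<^bsub>Zmod q\<^esub>"
        using kc by (simp add: add_pow_UP_Zmod[OF q1 ac(2)] Q.res_zero_eq)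
    qed
    then have "t = \<zero>\<^bsub>?P\<^esub>" using P.monic_mult_deg(2)[OF h(1) t(1)] ac(4) t(2) by fastforce
    then have kc0: "add_pow ?P ?k c = \<zero>\<^bsub>?P\<^esub>" using t hP by simp
    have "c j mod int p = 0" for j
    proof -
      have "(?k * c j) mod int q = 0"
        using fun_cong[OF kc0, of j] by (simp only: add_pow_UP_Zmod[OF q1 ac(2)] UP_0_1 Q.res_zero_eq)
      then have "int q dvd ?k * c j" by auto
      \<comment> \<open>This relies on \<open>r \<ge> 1\<close>; for \<open>r = 0\<close> the
        truncated exponent would make it false.\<close>
      moreover have "int q = ?k * int p" unfolding qi using r by (cases r) auto
      ultimately show ?thesis using p1 by auto
    qed
    then have "red c = \<zero>\<^bsub>?F\<^esub>" by (intro ext) (simp add: red_def reduce_UP_def UP_0_1 Z.res_zero_eq)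
    then have "\<Psi> c = \<zero>\<^bsub>K\<^esub>"
      using ring_hom_zero[OF \<Phi>(1) F.P.ring_axioms K.ring_axioms] by (simp add: \<Psi>_def)
    then show ?thesis using bc ac \<pi>(2) by simp
  qed
  show ?thesis unfolding p_lift_def
    using B.ring_axioms K.ring_axioms \<pi>(1) surj ker ann tors by blast
qed

theorem theorem3p1:
  fixes G :: "('g, 't) monoid_scheme"
    and K :: "nat \<Rightarrow> ('k, 's) ring_scheme"
    and n m :: "nat \<Rightarrow> nat"
    and h :: "nat \<Rightarrow> nat \<Rightarrow> int"
    and p r k :: nat
  assumes "group G" and "finite (carrier G)"
    and "prime p" and "gcd p (order G) = 1"
    and "\<And>i. i < k \<Longrightarrow> 1 \<le> n i"
    and "\<And>i. i < k \<Longrightarrow> 1 \<le> m i"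
    and "\<And>i. i < k \<Longrightarrow> field (K i)"
    and "\<And>i. i < k \<Longrightarrow> card (carrier (K i)) = p ^ m i"
    and "group_ring (Zmod p) G \<simeq> ring_direct_sum k (\<lambda>i. matrix_ring (n i) (K i))"
    and "1 \<le> r"
    and "\<And>i. i < k \<Longrightarrow> monic_UP (Zmod (p ^ r)) (h i)"
    and "\<And>i. i < k \<Longrightarrow> basic_irreducible p r (h i)"
    and "\<And>i. i < k \<Longrightarrow> deg (Zmod (p ^ r)) (h i) = m i"
  shows "group_ring (Zmod (p ^ r)) G \<simeq>
    ring_direct_sum k (\<lambda>i. matrix_ring (n i) (poly_quotient (Zmod (p ^ r)) (h i)))"
proof -
  let ?R = "\<lambda>i. poly_quotient (Zmod (p ^ r)) (h i)"
  have "\<exists>\<pi>. p_lift (int p) r (matrix_ring (n i) (?R i)) (matrix_ring (n i) (K i)) \<pi>" if i: "i < k" for i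
  proof -
    \<comment> \<open>Each \<open>K i\<close> is given only as a field of the right cardinality, so
      the reduction of the Galois ring is taken in whichever model the decomposition uses.\<close>
    have "\<exists>\<pi>. p_lift (int p) r (?R i) (K i) \<pi>"
      by (rule p_lift_poly_quotient[OF assms(3,10) refl assms(11)[OF i] assms(12)[OF i] _ assms(7)[OF i]])
        (use assms(6,8,13)[OF i] in simp_all)
    then show ?thesis using p_lift_matrix_ring by blast
  qed
  then have "\<exists>\<pi>. p_lift (int p) r (ring_direct_sum k (\<lambda>i. matrix_ring (n i) (?R i)))
      (ring_direct_sum k (\<lambda>i. matrix_ring (n i) (K i))) \<pi>"
    unfolding ring_direct_sum_def by (intro p_lift_RDirProd_list) auto
  then show ?thesis
    using group_ring_lift_iso[OF assms(1-4,10)] assms(9) unfolding is_ring_iso_def by blast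
qed

end
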